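(* Let $\epsilon\in(0,1)$ and let $\sigma\in\mathbb R_+$ be any threshold such that $\sigma\le\mathbb E(\|X\|^4)^{1/2}$. With probability at least $1-2\epsilon$, for any $\theta\in\mathbb S_d=\{\theta\in\mathbb R^d:\|\theta\|=1\}$, $$\left|\frac{\max\{\bar N(\theta),\sigma\}}{\max\{N(\theta),\sigma\}}-1\right|\le B_*\big(N(\theta)\big)+\frac{\tau_*\big(N(\theta)\big)}{\big[1-\tau_*\big(N(\theta)\big)\big]_+\big[1-B_*\big(N(\theta)\big)\big]_+}.$$
   Context: $X\in\mathbb R^d$ is a random vector of law $\mathrm P$, $X_1,\dots,X_n$ an i.i.d. sample from $\mathrm P$; $N(\theta)=\mathbb E(\langle\theta,X\rangle^2)$, $G=\mathbb E(XX^\top)$, $\mathbf{Tr}(G)=\mathbb E(\|X\|^2)$, and $\bar N(\theta)=\frac1n\sum_{i=1}^n\langle\theta,X_i\rangle^2$ is the classical empirical estimator. It is assumed that $\mathbb E(\|X\|^4)<\infty$ and that $$\kappa=\sup_{\theta\in\mathbb R^d,\ \mathbb E(\langle\theta,X\rangle^2)>0}\frac{\mathbb E(\langle\theta,X\rangle^4)}{\mathbb E(\langle\theta,X\rangle^2)^2}$$ is finite, with $\kappa>1$. Put $c=\frac{15}{8\log(2)(\sqrt2-1)}\exp\big(\frac{1+2\sqrt2}{2}\big)$, $a=1/2$, $K=1+\big\lceil a^{-1}\log\big(\frac{n}{72(2+c)\kappa^{1/2}}\big)\big\rceil$, assumed $\ge1$, $R=\max_{i=1,\dots,n}\|X_i\|$,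 $$\lambda_*(t)=\sqrt{\frac{2}{n(\kappa-1)}\Big(\frac{(2+3c)\,\mathbb E(\|X\|^4)^{1/2}}{4(2+c)\kappa^{1/2}\max\{t,\sigma\}}+\log(K/\epsilon)\Big)},\qquad \tau_*(t)=\frac{\lambda_*(t)^2\exp(a/2)R^4}{3\max\{t,\sigma\}^2},$$ $$\zeta_*(t)=\sqrt{2.032(\kappa-1)\Big(\frac{0.73\,\mathbf{Tr}(G)}{t}+\log(K)+\log(\epsilon^{-1})\Big)}+\sqrt{\frac{98.5\,\kappa\,\mathbf{Tr}(G)}{t}},$$ $$B_*(t)=\frac{n^{-1/2}\zeta_*(\max\{t,\sigma\})}{1-4n^{-1/2}\zeta_*(\max\{t,\sigma\})}\ \text{ if }\big[6+(\kappa-1)^{-1}\big]\zeta_*(\max\{t,\sigma\})\le\sqrt n,\qquad B_*(t)=+\infty\text{ otherwise.}$$ Here $[x]_+=\max\{x,0\}$; the right-hand side is read as $+\infty$ (and the inequality as void) whenever $B_*=+\infty$ or one of the factors in the denominator vanishes. "With probability at least $p$" means that the event contains a measurable event of probability at least $p$. *)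

theory Defs
  imports "HOL-Probability.Probability"
begin

text \<open>
  Expectations of functions of the random vector \<open>X\<close> are integrals with respect to its law \<open>P\<close>,
  a probability measure on the Borel sets of \<open>real ^ 'd\<close>.
\<close>

definition quad_form :: "(real ^ 'd) measure \<Rightarrow> real ^ 'd \<Rightarrow> real" where
  "quad_form P \<theta> = (\<integral>x. (\<theta> \<bullet> x)\<^sup>2 \<partial>P)"

definition gram :: "(real ^ 'd) measure \<Rightarrow> real ^ 'd ^ 'd" where
  "gram P = (\<integral>x. (\<chi> i j. x $ i * x $ j) \<partial>P)"

definition emp_quad_form :: "nat \<Rightarrow> (nat \<Rightarrow> real ^ 'd) \<Rightarrow> real ^ 'd \<Rightarrow> real" where
  "emp_quad_form n x \<theta> = (1 / real n) * (\<Sum>i = 1..n. (\<theta> \<bullet> x i)\<^sup>2)"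

definition sample_radius :: "nat \<Rightarrow> (nat \<Rightarrow> real ^ 'd) \<Rightarrow> real" where
  "sample_radius n x = Max ((\<lambda>i. norm (x i)) ` {1..n})"

text \<open>
  The supremum is taken in the extended reals, so that an unbounded family has supremum
  \<open>\<infinity>\<close> and the empty one (when \<open>X = 0\<close> almost surely) has supremum \<open>-\<infinity>\<close>. The real number
  \<open>\<kappa>\<close> below is the value of this supremum, assumed finite.
\<close>

definition kurtosis_sup :: "(real ^ 'd) measure \<Rightarrow> ereal" where
  "kurtosis_sup P =
     (SUP \<theta> \<in> {\<theta>. quad_form P \<theta> > 0}. ereal ((\<integral>x. (\<theta> \<bullet> x) ^ 4 \<partial>P) / (quad_form P \<theta>)\<^sup>2))"

definition c_const :: real where
  "c_const = 15 / (8 * ln 2 * (sqrt 2 - 1)) * exp ((1 + 2 * sqrt 2) / 2)"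

definition a_const :: real where
  "a_const = 1 / 2"

definition K_const :: "real \<Rightarrow> nat \<Rightarrow> int" where
  "K_const \<kappa> n = 1 + \<lceil>inverse a_const * ln (real n / (72 * (2 + c_const) * sqrt \<kappa>))\<rceil>"

definition lambda_star ::
    "(real ^ 'd) measure \<Rightarrow> real \<Rightarrow> nat \<Rightarrow> real \<Rightarrow> real \<Rightarrow> real \<Rightarrow> real" where
  "lambda_star P \<kappa> n \<epsilon> \<sigma> t =
     sqrt (2 / (real n * (\<kappa> - 1)) *
       ((2 + 3 * c_const) * sqrt (\<integral>x. norm x ^ 4 \<partial>P) / (4 * (2 + c_const) * sqrt \<kappa> * max t \<sigma>)
        + ln (real_of_int (K_const \<kappa> n) / \<epsilon>)))"

definition tau_star ::
    "(real ^ 'd) measure \<Rightarrow> real \<Rightarrow> nat \<Rightarrow> real \<Rightarrow> real \<Rightarrow> real \<Rightarrow> real \<Rightarrow> real" where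
  "tau_star P \<kappa> n \<epsilon> \<sigma> R t =
     (lambda_star P \<kappa> n \<epsilon> \<sigma> t)\<^sup>2 * exp (a_const / 2) * R ^ 4 / (3 * (max t \<sigma>)\<^sup>2)"

definition zeta_star ::
    "(real ^ 'd) measure \<Rightarrow> real \<Rightarrow> nat \<Rightarrow> real \<Rightarrow> real \<Rightarrow> real" where
  "zeta_star P \<kappa> n \<epsilon> t =
     sqrt (2.032 * (\<kappa> - 1) *
       (0.73 * trace (gram P) / t + ln (real_of_int (K_const \<kappa> n)) + ln (inverse \<epsilon>)))
     + sqrt (98.5 * \<kappa> * trace (gram P) / t)"

text \<open>
  If \<open>max t \<sigma> = 0\<close>, then \<open>zeta_star\<close> is mathematically \<open>+\<infinity>\<close> and hence so is \<open>B_star\<close>. The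
  condition \<open>0 < max t \<sigma>\<close> expresses this, as division by zero yields zero in HOL.
\<close>

definition B_star ::
    "(real ^ 'd) measure \<Rightarrow> real \<Rightarrow> nat \<Rightarrow> real \<Rightarrow> real \<Rightarrow> real \<Rightarrow> ereal" where
  "B_star P \<kappa> n \<epsilon> \<sigma> t =
     (let z = zeta_star P \<kappa> n \<epsilon> (max t \<sigma>) in
      if 0 < max t \<sigma> \<and> (6 + inverse (\<kappa> - 1)) * z \<le> sqrt (real n)
      then ereal ((z / sqrt (real n)) / (1 - 4 * (z / sqrt (real n))))
      else \<infinity>)"

text \<open>
  \<open>B + \<tau> / ([1 - \<tau>]\<^sub>+ [1 - B]\<^sub>+)\<close>, read as \<open>+\<infinity>\<close> if \<open>B = +\<infinity>\<close> or if a factor of the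
  denominator vanishes (even when \<open>\<tau> = 0\<close>).
\<close>

definition deviation_bound :: "ereal \<Rightarrow> real \<Rightarrow> ereal" where
  "deviation_bound B \<tau> =
     (if B = \<infinity> \<or> max (1 - ereal \<tau>) 0 = 0 \<or> max (1 - B) 0 = 0 then \<infinity>
      else B + ereal \<tau> / (max (1 - ereal \<tau>) 0 * max (1 - B) 0))"

end

theory Submission
  imports Defs
begin

text \<open>
  The proof is a PAC-Bayesian argument. Fix a level \<open>l\<close> and look at the centred variables
  \<open>\<langle>\<theta>, X\<^sub>i\<rangle>\<^sup>2 - l\<close> for directions \<open>\<theta>\<close> of arbitrary length, so that scaling a unit direction
  by \<open>sqrt (l / N(\<theta>))\<close> gives them mean zero and variance at most \<open>(\<kappa> - 1) l\<^sup>2\<close>. The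
  variables have only two moments, so exponential inequalities are applied to a truncation of
  them: \<open>soft_clip\<close> is bounded, agrees with the identity to second order at \<open>0\<close>, and its
  exponential lies below \<open>1 + z + z\<^sup>2 / 2\<close> (\<open>exp_soft_clip_le\<close>).

  Uniformity in \<open>\<theta>\<close> comes from replacing \<open>\<theta>\<close> by a Gaussian vector centred at \<open>\<theta>\<close>, at the
  price of a Kullback divergence \<open>\<parallel>\<theta>\<parallel>\<^sup>2 / (2 v\<^sup>2)\<close> from the centred Gaussian prior
  (\<open>pac_bayes_gauss\<close>); this price does not depend on the dimension. A Gaussian average of
  \<open>soft_clip\<close> may fall below the value at the centre, as \<open>soft_clip\<close> is not convex. The deficit is
  bounded both by a multiple of the variance and by a constant, because \<open>soft_clip\<close> is
  semiconvex and bounded. It is compensated by a logarithmic term inside the average, whose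
  own mean is estimated by pairing the perturbations \<open>\<eta>\<close> and \<open>- \<eta>\<close>
  (\<open>log_weight_gauss_mean_ge\<close>). The outcome is \<open>uniform_soft_clip_bound\<close>: with large probability
  the empirical sums of the truncated variables are controlled for all \<open>\<theta>\<close> at once, in both
  directions, with the variance factor \<open>\<kappa> - 1\<close>.

  For the classical estimator the truncation has to be removed. It costs at most
  \<open>z\<^sup>3 / 3\<close> per observation, and on the sample \<open>\<langle>\<theta>, X\<^sub>i\<rangle>\<^sup>2 \<le> R\<^sup>2\<close>; this is where \<open>\<tau>\<^sub>*\<close> comes
  from. In the upper direction the conclusion is immediate (\<open>relative_upper_deviation\<close>). In the
  lower direction the truncation error is of order \<open>l\<^sup>2\<close>, which is comparable with \<open>\<tau>\<^sub>*\<close> only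
  if \<open>R\<^sup>2\<close> is not much smaller than \<open>N(\<theta>)\<close>. The inequality is therefore used at the larger scale
  \<open>l / ((1 - B) N(\<theta>))\<close>: there its right-hand side is not positive, which forces
  \<open>R\<^sup>2 \<ge> (1 - B) N(\<theta>)\<close>, and the same inequality then yields the lower bound
  (\<open>relative_lower_deviation\<close>).

  The best level and perturbation size depend on \<open>max {N(\<theta>), \<sigma>}\<close>. They are chosen on a
  geometric grid with ratio \<open>exp (1/2)\<close>; whenever \<open>B\<^sub>*\<close> is finite, this quantity is within a
  factor \<open>exp (1/4)\<close> of one of the first \<open>K\<close> grid points (\<open>exists_grid_point\<close>), so that a
  union bound over \<open>2 K\<close> events suffices, and the mismatch only enlarges the numerical constants
  (\<open>parameter_bounds\<close>).
\<close>

section \<open>A bounded substitute for the identity\<close>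

lemma exp_third_le: "exp (1/3 :: real) \<le> 1.397"
proof (rule ccontr)
  assume "\<not> ?thesis"
  then have "1.397 ^ 3 < exp (1/3 :: real) ^ 3" by (intro power_strict_mono) auto
  also have "exp (1/3::real) ^ 3 = exp 1" by (simp flip: exp_of_nat_mult)
  finally show False using e_less_272 by (simp add: eval_nat_numeral)
qed

lemma exp_two_thirds_le: "22 * exp (2/3 :: real) \<le> 43"
proof -
  have "exp (2/3::real) = exp (1/3) ^ 2" by (simp flip: exp_of_nat_mult)
  also have "\<dots> \<le> 1.397 ^ 2" using exp_third_le by (intro power_mono) auto
  finally show ?thesis by (simp add: power2_eq_square)
qed

text \<open>
  Below \<open>0\<close> the identity can be kept because \<open>exp z \<le> 1 + z + z\<^sup>2 / 2\<close> holds there; it is cut at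
  \<open>- ln 2\<close>, the minimum of \<open>ln (1 + z + z\<^sup>2 / 2)\<close>. Above \<open>0\<close> the cubic \<open>z - z\<^sup>3 / 3\<close> is followed up
  to its maximum at \<open>1\<close>, which makes the derivative continuous there.
\<close>

definition soft_clip :: "real \<Rightarrow> real" where
  "soft_clip z = (if z \<le> 0 then max z (- ln 2) else if z \<le> 1 then z - z ^ 3 / 3 else 2 / 3)"

lemma soft_clip_measurable [measurable]: "soft_clip \<in> borel_measurable borel"
  unfolding soft_clip_def[abs_def] by measurable

lemma soft_clip_ge: "- ln 2 \<le> soft_clip z"
proof -
  have "0 \<le> z - z ^ 3 / 3" if "0 < z" "z \<le> 1"
    using that mult_left_le[of "z^2" z] power_le_one[of z 2] by (simp add: power3_eq_cube power2_eq_square)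
  moreover have "0 \<le> ln (2::real)" by simp
  ultimately show ?thesis unfolding soft_clip_def by (smt (verit) max.cobounded2 divide_nonneg_pos)
qed

lemma cubic_le_two_thirds:
  fixes z :: real assumes "0 \<le> z" shows "z - z ^ 3 / 3 \<le> 2 / 3"
proof -
  have "0 \<le> (z - 1)\<^sup>2 * (z + 2)" using assms by simp
  then show ?thesis by (simp add: power2_eq_square power3_eq_cube algebra_simps)
qed

lemma soft_clip_le: "soft_clip z \<le> 2 / 3"
proof -
  have "- ln 2 \<le> (2/3 :: real)" using ln2_ge_two_thirds by linarith
  then show ?thesis using cubic_le_two_thirds[of z] by (auto simp: soft_clip_def)
qed

lemma soft_clip_pos: "0 < z \<Longrightarrow> 0 < soft_clip z"
proof (cases "z \<le> 1")
  case True
  assume z: "0 < z"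
  have "z\<^sup>2 \<le> 1" using True z by (intro power_le_one) auto
  then have "0 < z * (1 - z\<^sup>2 / 3)" using z by simp
  also have "\<dots> = z - z ^ 3 / 3" by (simp add: power2_eq_square power3_eq_cube algebra_simps)
  finally show ?thesis using True z by (simp add: soft_clip_def)
qed (auto simp: soft_clip_def)

text \<open>
  Removing the truncation costs a cubic term only on the positive side; the bound \<open>w\<close> on \<open>z\<close> is kept
  separate because \<open>z = s Y - l\<close> is later compared with \<open>w = s Y\<close>.
\<close>

lemma soft_clip_ge_cubic:
  assumes "z \<le> w" "0 \<le> w" shows "z - w ^ 3 / 3 \<le> soft_clip z"
proof (cases "z \<le> 0")
  case True
  have "0 \<le> w ^ 3 / 3" using assms by simp
  then have "z - w ^ 3 / 3 \<le> z" by linarith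
  then show ?thesis using True by (simp add: soft_clip_def le_max_iff_disj)
next
  case False
  then have "z ^ 3 \<le> w ^ 3" using assms by (intro power_mono) auto
  then show ?thesis using False cubic_le_two_thirds[of z] by (auto simp: soft_clip_def)
qed

lemma exp_nonpos_le_quadratic:
  fixes z :: real assumes "z \<le> 0" shows "exp z \<le> 1 + z + z\<^sup>2 / 2"
proof -
  have e: "1 - z + z\<^sup>2 / 2 \<le> exp (- z)" using exp_lower_Taylor_quadratic[of "- z"] assms by simp
  have p: "0 \<le> 1 + z + z\<^sup>2 / 2" using zero_le_power2[of "1 + z"] by (simp add: power2_sum)
  have "1 \<le> 1 + z ^ 4 / 4" by simp
  also have "\<dots> = (1 + z + z\<^sup>2 / 2) * (1 - z + z\<^sup>2 / 2)"
    by (simp add: algebra_simps power2_eq_square eval_nat_numeral)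
  also have "\<dots> \<le> (1 + z + z\<^sup>2 / 2) * exp (- z)" by (intro mult_left_mono e p)
  finally have "1 * exp z \<le> (1 + z + z\<^sup>2 / 2) * exp (- z) * exp z" by (intro mult_right_mono) auto
  then show ?thesis by (simp add: mult.assoc flip: exp_add)
qed

text \<open>
  The derivative of \<open>ln (1 + z + z\<^sup>2 / 2) - z\<close> is at least \<open>- z\<^sup>2 / 2\<close>.
\<close>

lemma exp_cubic_le_quadratic:
  fixes z :: real assumes "0 \<le> z" shows "exp (z - z ^ 3 / 6) \<le> 1 + z + z\<^sup>2 / 2"
proof -
  define f where "f z = ln (1 + z + z\<^sup>2 / 2) - z + z ^ 3 / 6" for z :: real
  have pos: "0 < 1 + x + x\<^sup>2 / 2" if "0 \<le> x" for x :: real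
    using that by (simp add: add_pos_nonneg)
  have "f 0 \<le> f z"
  proof (rule DERIV_nonneg_imp_nondecreasing[OF assms])
    fix x :: real assume x: "0 \<le> x" "x \<le> z"
    have "(f has_real_derivative (1 + x) / (1 + x + x\<^sup>2 / 2) - 1 + x\<^sup>2 / 2) (at x)"
      unfolding f_def using pos[OF x(1)]
      by (auto intro!: derivative_eq_intros simp: field_simps)
    moreover have "(1 + x) / (1 + x + x\<^sup>2 / 2) - 1 + x\<^sup>2 / 2
        = (x\<^sup>2 / 2) * (x + x\<^sup>2 / 2) / (1 + x + x\<^sup>2 / 2)"
      using pos[OF x(1)] by (simp add: field_simps)
    moreover have "0 \<le> \<dots>" using x by simp
    ultimately show "\<exists>y. (f has_real_derivative y) (at x) \<and> 0 \<le> y" by metis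
  qed
  then have "z - z ^ 3 / 6 \<le> ln (1 + z + z\<^sup>2 / 2)" by (simp add: f_def)
  then show ?thesis using pos[OF assms] by (simp add: ln_ge_iff)
qed

lemma exp_soft_clip_le: "exp (soft_clip z) \<le> 1 + z + z\<^sup>2 / 2"
proof -
  consider "z \<le> 0" | "0 < z" "z \<le> 1" | "1 < z" by linarith
  then show ?thesis
  proof cases
    case 1
    have "exp (- ln 2) \<le> 1 + z + z\<^sup>2 / 2"
      using zero_le_power2[of "1 + z"] by (simp add: exp_minus power2_sum)
    then show ?thesis using 1 exp_nonpos_le_quadratic[of z] by (simp add: soft_clip_def max_def)
  next
    case 2
    have "exp (z - z ^ 3 / 3) \<le> exp (z - z ^ 3 / 6)" using 2 by simp
    also have "\<dots> \<le> 1 + z + z\<^sup>2 / 2" using 2 by (intro exp_cubic_le_quadratic) auto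
    finally show ?thesis using 2 by (simp add: soft_clip_def)
  next
    case 3
    have "0 \<le> z\<^sup>2" by simp
    moreover have "exp (2/3 :: real) \<le> 2" using exp_two_thirds_le by linarith
    ultimately have "exp (2/3) \<le> 1 + z + z\<^sup>2 / 2" using 3 by linarith
    then show ?thesis using 3 by (simp add: soft_clip_def)
  qed
qed

text \<open>
  The second derivative of \<open>soft_clip\<close> is nowhere smaller than \<open>-2\<close>, and its kinks are convex, so
  \<open>soft_clip z + z\<^sup>2\<close> has a supporting line at every point. Integrating this line shows that
  replacing a random argument by its mean gains at most one variance.
\<close>

lemma soft_clip_semiconvex:
  "\<exists>g. \<forall>z. soft_clip m + g * (z - m) - (z - m)\<^sup>2 \<le> soft_clip z"
proof -
  consider "m \<le> - ln 2" | "- ln 2 < m" "m \<le> 0" | "0 < m" "m \<le> 1" | "1 < m" by linarith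
  then show ?thesis
  proof cases
    case 1
    then have "soft_clip m = - ln 2" using order_trans[OF 1, of 0] by (simp add: soft_clip_def)
    then show ?thesis using soft_clip_ge by (intro exI[of _ 0]) (smt (verit) zero_le_power2 mult_zero_left)
  next
    case 2
    have "soft_clip m + 1 * (z - m) - (z - m)\<^sup>2 \<le> soft_clip z" for z
    proof -
      have *: "soft_clip m = m" using 2 by (simp add: soft_clip_def)
      have sq: "z\<^sup>2 \<le> (z - m)\<^sup>2" if "0 < z" using that 2 by (intro power_mono) auto
      have "z ^ 3 / 3 \<le> z\<^sup>2" if "0 < z" "z \<le> 1"
        using that by (simp add: power2_eq_square power3_eq_cube)
      moreover have "z - z\<^sup>2 \<le> 2/3" using zero_le_power2[of "z - 1/2"]
        by (simp add: power2_eq_square algebra_simps)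
      moreover have "0 \<le> (z - m)\<^sup>2" by simp
      ultimately show ?thesis using sq unfolding * unfolding soft_clip_def
        by (cases "z \<le> 0"; cases "z \<le> 1"; simp add: le_max_iff_disj)
    qed
    then show ?thesis by blast
  next
    case 3
    have "soft_clip m + (1 - m\<^sup>2) * (z - m) - (z - m)\<^sup>2 \<le> soft_clip z" for z
    proof -
      have *: "soft_clip m = m - m ^ 3 / 3" using 3 by (simp add: soft_clip_def)
      consider "z \<le> 0" | "0 < z" "z \<le> 1" | "1 < z" by linarith
      then show ?thesis
      proof cases
        case 1
        define w where "w = m - z"
        have w: "m \<le> w" using 1 by (simp add: w_def)
        have "m * m * w \<le> 1 * w * w" using w 3 by (intro mult_mono mult_le_one) (auto simp: mult_le_one)
        moreover have "0 \<le> m ^ 3" using 3 by simp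
        ultimately have "m - m ^ 3 / 3 + (1 - m\<^sup>2) * (z - m) - (z - m)\<^sup>2 \<le> z"
          unfolding w_def by (simp add: power2_eq_square power3_eq_cube algebra_simps)
        then show ?thesis using 1 unfolding * by (simp add: soft_clip_def)
      next
        case 2
        have "(z - m)\<^sup>2 * ((z + 2 * m) / 3) \<le> (z - m)\<^sup>2 * 1" using 2 3 by (intro mult_left_mono) auto
        moreover have "m - m ^ 3 / 3 + (1 - m\<^sup>2) * (z - m) - (z - z ^ 3 / 3) = (z - m)\<^sup>2 * ((z + 2 * m) / 3)"
          by (simp add: power2_eq_square power3_eq_cube algebra_simps) 
        ultimately show ?thesis using 2 unfolding * by (simp add: soft_clip_def)
      next
        case z: 3
        have "0 \<le> (1 - m)\<^sup>2 * ((1 - m) * 2 / 3)" using 3 by simp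
        moreover have "0 \<le> (z - 1) * ((z - 1) + (1 - m)\<^sup>2)" using z by simp
        moreover have "2/3 - (m - m ^ 3 / 3 + (1 - m\<^sup>2) * (z - m) - (z - m)\<^sup>2)
           = (1 - m)\<^sup>2 * ((1 - m) * 2 / 3) + (z - 1) * ((z - 1) + (1 - m)\<^sup>2)"
          by (simp add: power2_eq_square power3_eq_cube field_simps)
        ultimately have "m - m ^ 3 / 3 + (1 - m\<^sup>2) * (z - m) - (z - m)\<^sup>2 \<le> 2/3" by linarith
        then show ?thesis using z unfolding * unfolding soft_clip_def by simp
      qed
    qed
    then show ?thesis by blast
  next
    case 4
    have "soft_clip m + 0 * (z - m) - (z - m)\<^sup>2 \<le> soft_clip z" for z
    proof -
      have *: "soft_clip m = 2/3" using 4 by (simp add: soft_clip_def)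
      have sq: "(1 - z)\<^sup>2 \<le> (z - m)\<^sup>2" if "z \<le> 1"
        using that 4 power_mono[of "1 - z" "m - z" 2] by (simp add: power2_commute)
      have "(1 - z)\<^sup>2 * ((2 + z) / 3) \<le> (1 - z)\<^sup>2 * 1" if "z \<le> 1"
        using that by (intro mult_left_mono) auto
      moreover have "2/3 - (z - z ^ 3 / 3) = (1 - z)\<^sup>2 * ((2 + z) / 3)"
        by (simp add: power2_eq_square power3_eq_cube algebra_simps)
      moreover have "2/3 - (1 - z)\<^sup>2 \<le> z" using zero_le_power2[of "z - 1/2"]
        by (simp add: power2_eq_square algebra_simps)
      moreover have "0 \<le> (z - m)\<^sup>2" by simp
      ultimately show ?thesis using sq unfolding * unfolding soft_clip_def
        by (cases "z \<le> 0"; cases "z \<le> 1"; simp add: le_max_iff_disj)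
    qed
    then show ?thesis by blast
  qed
qed

section \<open>Gaussian vectors\<close>

text \<open>
  The centred Gaussian law on \<open>real ^ 'd\<close> with covariance matrix \<open>v\<^sup>2\<close> times the identity.
\<close>

definition gauss_vec :: "real \<Rightarrow> (real ^ 'd) measure" where
  "gauss_vec v = distr (PiM UNIV (\<lambda>i::'d. density lborel (normal_density 0 v))) borel (\<lambda>f. \<chi> i. f i)"

lemma sets_gauss_vec [simp, measurable_cong]: "sets (gauss_vec v) = sets borel"
  by (simp add: gauss_vec_def)

lemma space_gauss_vec [simp]: "space (gauss_vec v) = UNIV"
  by (simp add: gauss_vec_def)

lemma measurable_vec_lambda_PiM [measurable]:
  assumes "\<And>i::'d::finite. sets (N i) = sets (borel :: real measure)"
  shows "(\<lambda>f. \<chi> i. f i) \<in> PiM UNIV N \<rightarrow>\<^sub>M (borel :: (real ^ 'd) measure)"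
proof (subst borel_measurable_euclidean_space, intro ballI)
  fix b :: "real ^ 'd" assume "b \<in> Basis"
  then obtain i where b: "b = axis i 1" by (auto simp: Basis_vec_def)
  have "(\<lambda>f. f i) \<in> PiM UNIV N \<rightarrow>\<^sub>M N i" by (rule measurable_component_singleton) simp
  then have "(\<lambda>f. f i) \<in> PiM UNIV N \<rightarrow>\<^sub>M borel" using measurable_cong_sets[OF refl assms[of i]] by blast
  then show "(\<lambda>f. (\<chi> i. f i) \<bullet> b) \<in> borel_measurable (PiM UNIV N)"
    by (simp add: b inner_axis)
qed

lemma prob_space_gauss_vec: "0 < v \<Longrightarrow> prob_space (gauss_vec v)"
  unfolding gauss_vec_def
  by (intro prob_space.prob_space_distr prob_space_PiM prob_space_normal_density measurable_vec_lambda_PiM) auto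

text \<open>
  A linear combination of independent normal variables is normal. Coordinates with coefficient \<open>0\<close>
  are discarded first, since a normal density needs a positive standard deviation.
\<close>

lemma distributed_inner_gauss_vec:
  fixes x :: "real ^ 'd"
  assumes v: "0 < v" and x: "x \<noteq> 0"
  shows "distributed (gauss_vec v) lborel (\<lambda>\<eta>. \<eta> \<bullet> x) (normal_density 0 (v * norm x))"
proof -
  define N where "N = (\<lambda>i::'d. density lborel (normal_density 0 v))"
  have N: "prob_space (N i)" for i unfolding N_def using v by (rule prob_space_normal_density)
  interpret Q: prob_space "PiM UNIV N" by (intro prob_space_PiM N)
  have sN [measurable_cong]: "sets (N i) = sets borel" for i by (simp add: N_def)
  have comp [measurable]: "(\<lambda>f. f i) \<in> PiM UNIV N \<rightarrow>\<^sub>M borel" for i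
    using measurable_component_singleton[of i UNIV N] measurable_cong_sets[OF refl sN] by blast
  define I where "I = {i. x $ i \<noteq> 0}"
  have I: "finite I" "I \<noteq> {}" using x by (auto simp: I_def vec_eq_iff)
  have di: "distr (PiM UNIV N) borel (\<lambda>f. f i) = N i" for i
  proof -
    have "distr (PiM UNIV N) (N i) (\<lambda>f. f i) = N i" by (intro distr_PiM_component N) auto
    then show ?thesis using distr_cong[OF refl, of borel "N i"] sN by metis
  qed
  have indep: "Q.indep_vars (\<lambda>_. borel) (\<lambda>i f. f i) UNIV"
  proof (subst Q.indep_vars_iff_distr_eq_PiM)
    have "distr (PiM UNIV N) (PiM UNIV (\<lambda>_. borel)) (\<lambda>f. f) = PiM UNIV N"
      by (intro distr_id2 sets_PiM_cong) (auto simp: sN)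
    then show "distr (PiM UNIV N) (PiM UNIV (\<lambda>_. borel)) (\<lambda>f. \<lambda>i\<in>UNIV. f i) =
        PiM UNIV (\<lambda>i. distr (PiM UNIV N) borel (\<lambda>f. f i))"
      by (simp add: di restrict_def)
  qed auto
  have indep': "Q.indep_vars (\<lambda>_. borel) (\<lambda>i f. x $ i * f i) I"
    by (rule Q.indep_vars_compose2[OF Q.indep_vars_subset[OF indep]]) auto
  have "distributed (PiM UNIV N) lborel (\<lambda>f. \<Sum>i\<in>I. x $ i * f i)
      (normal_density (\<Sum>i\<in>I. 0) (sqrt (\<Sum>i\<in>I. (\<bar>x $ i\<bar> * v)\<^sup>2)))"
  proof (rule Q.sum_indep_normal[OF I indep'])
    fix i assume i: "i \<in> I"
    then show "0 < \<bar>x $ i\<bar> * v" using v by (simp add: I_def)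
    have d0: "distributed (PiM UNIV N) lborel (\<lambda>f. f i) (normal_density 0 v)"
      unfolding distributed_def
      using di[of i] distr_cong[OF refl, of lborel borel "PiM UNIV N" "\<lambda>f. f i"] comp[of i]
      by (auto simp: N_def)
    show "distributed (PiM UNIV N) lborel (\<lambda>f. x $ i * f i) (normal_density 0 (\<bar>x $ i\<bar> * v))"
      using Q.normal_density_affine[OF d0 v, of "x $ i" 0] i by (simp add: I_def)
  qed
  also have "(\<Sum>i\<in>I. (\<bar>x $ i\<bar> * v)\<^sup>2) = (\<Sum>i\<in>UNIV. (\<bar>x $ i\<bar> * v)\<^sup>2)"
    by (rule sum.mono_neutral_left) (auto simp: I_def)
  also have "sqrt \<dots> = v * norm x"
    using v by (simp add: norm_vec_def L2_set_def power_mult_distrib flip: sum_distrib_right)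
       (simp add: real_sqrt_mult)
  also have "(\<lambda>f. \<Sum>i\<in>I. x $ i * f i) = (\<lambda>f. (\<chi> i. f i) \<bullet> x)"
    by (rule ext, simp add: inner_vec_def mult.commute, rule sum.mono_neutral_left) (auto simp: I_def)
  finally have D: "distributed (PiM UNIV N) lborel (\<lambda>f. (\<chi> i. f i) \<bullet> x) (normal_density 0 (v * norm x))"
    by simp
  have "distr (gauss_vec v) lborel (\<lambda>\<eta>. \<eta> \<bullet> x) = distr (PiM UNIV N) lborel (\<lambda>f. (\<chi> i. f i) \<bullet> x)"
    unfolding gauss_vec_def N_def by (subst distr_distr) (auto simp: comp_def)
  then show ?thesis using D unfolding distributed_def by auto
qed

lemma integral_inner_gauss_vec:
  fixes x :: "real ^ 'd" and f :: "real \<Rightarrow> real"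
  assumes v: "0 < v" and x: "x \<noteq> 0" and f: "f \<in> borel_measurable borel"
  shows "integrable (gauss_vec v) (\<lambda>\<eta>. f (\<eta> \<bullet> x)) \<longleftrightarrow>
      integrable lborel (\<lambda>z. normal_density 0 (v * norm x) z * f z)"
    and "(\<integral>\<eta>. f (\<eta> \<bullet> x) \<partial>gauss_vec v) = (\<integral>z. normal_density 0 (v * norm x) z * f z \<partial>lborel)"
  using distributed_integrable[OF distributed_inner_gauss_vec[OF v x], of f]
    distributed_integral[OF distributed_inner_gauss_vec[OF v x], of f] f v x
  by (simp_all add: normal_density_nonneg)

lemma gauss_vec_moments:
  fixes x :: "real ^ 'd"
  assumes v: "0 < v"
  shows "integrable (gauss_vec v) (\<lambda>\<eta>. (\<eta> \<bullet> x) ^ k)"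
    and "(\<integral>\<eta>. \<eta> \<bullet> x \<partial>gauss_vec v) = 0"
    and "(\<integral>\<eta>. (\<eta> \<bullet> x)\<^sup>2 \<partial>gauss_vec v) = v\<^sup>2 * (norm x)\<^sup>2"
    and "(\<integral>\<eta>. (\<eta> \<bullet> x) ^ 3 \<partial>gauss_vec v) = 0"
    and "(\<integral>\<eta>. (\<eta> \<bullet> x) ^ 4 \<partial>gauss_vec v) = 3 * (v\<^sup>2 * (norm x)\<^sup>2)\<^sup>2"
proof -
  interpret prob_space "gauss_vec v :: (real ^ 'd) measure" by (rule prob_space_gauss_vec[OF v])
  show "integrable (gauss_vec v) (\<lambda>\<eta>. (\<eta> \<bullet> x) ^ k)"
  proof (cases "x = 0")
    case False
    then show ?thesis
      using integral_inner_gauss_vec(1)[OF v False, of "\<lambda>z. z ^ k"] integrable_normal_moment[of "v * norm x" 0 k] v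
      by simp
  qed simp
  have "(\<integral>\<eta>. \<eta> \<bullet> x \<partial>gauss_vec v) = 0 \<and> (\<integral>\<eta>. (\<eta> \<bullet> x)\<^sup>2 \<partial>gauss_vec v) = v\<^sup>2 * (norm x)\<^sup>2
    \<and> (\<integral>\<eta>. (\<eta> \<bullet> x) ^ 3 \<partial>gauss_vec v) = 0
    \<and> (\<integral>\<eta>. (\<eta> \<bullet> x) ^ 4 \<partial>gauss_vec v) = 3 * (v\<^sup>2 * (norm x)\<^sup>2)\<^sup>2"
  proof (cases "x = 0")
    case False
    then have pos: "0 < v * norm x" using v by simp
    note I = integral_inner_gauss_vec(2)[OF v False]
    show ?thesis
      using I[of "\<lambda>z. z"] I[of "\<lambda>z. z\<^sup>2"] I[of "\<lambda>z. z ^ 3"] I[of "\<lambda>z. z ^ 4"]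
        integral_normal_moment_odd[OF pos, of 0 0] integral_normal_moment_even[OF pos, of 0 1]
        integral_normal_moment_odd[OF pos, of 0 1] integral_normal_moment_even[OF pos, of 0 2]
      by (simp add: fact_numeral power_mult_distrib power_divide eval_nat_numeral)
  qed simp
  then show "(\<integral>\<eta>. \<eta> \<bullet> x \<partial>gauss_vec v) = 0"
    "(\<integral>\<eta>. (\<eta> \<bullet> x)\<^sup>2 \<partial>gauss_vec v) = v\<^sup>2 * (norm x)\<^sup>2"
    "(\<integral>\<eta>. (\<eta> \<bullet> x) ^ 3 \<partial>gauss_vec v) = 0"
    "(\<integral>\<eta>. (\<eta> \<bullet> x) ^ 4 \<partial>gauss_vec v) = 3 * (v\<^sup>2 * (norm x)\<^sup>2)\<^sup>2"
    by auto
qed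

lemma gauss_vec_symmetric:
  fixes x :: "real ^ 'd" and f :: "real \<Rightarrow> real"
  assumes v: "0 < v" and f: "f \<in> borel_measurable borel"
  shows "(\<integral>\<eta>. f (- (\<eta> \<bullet> x)) \<partial>gauss_vec v) = (\<integral>\<eta>. f (\<eta> \<bullet> x) \<partial>gauss_vec v)"
proof (cases "x = 0")
  case False
  have [measurable]: "f \<in> borel_measurable borel" by fact
  show ?thesis
    using integral_inner_gauss_vec(2)[OF v False f]
      integral_inner_gauss_vec(2)[OF v False, of "\<lambda>z. f (- z)"]
      lborel_integral_real_affine[of "-1" "\<lambda>z. normal_density 0 (v * norm x) z * f z" 0]
    by (auto simp: normal_density_def)
qed simp

lemma nn_integral_normal_translate:
  fixes f :: "real \<Rightarrow> ennreal"
  assumes v: "0 < v" and f [measurable]: "f \<in> borel_measurable borel"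
  shows "(\<integral>\<^sup>+z. ennreal (exp (- (t * z) / v\<^sup>2 - t\<^sup>2 / (2 * v\<^sup>2))) * f (t + z) \<partial>density lborel (normal_density 0 v))
    = (\<integral>\<^sup>+z. f z \<partial>density lborel (normal_density 0 v))"
proof -
  have "(\<integral>\<^sup>+z. f z \<partial>density lborel (normal_density 0 v)) = (\<integral>\<^sup>+z. ennreal (normal_density 0 v z) * f z \<partial>lborel)"
    by (subst nn_integral_density) auto
  also have "\<dots> = (\<integral>\<^sup>+z. ennreal (normal_density 0 v (t + z)) * f (t + z) \<partial>lborel)"
    by (subst nn_integral_real_affine[where c=1 and t=t]) auto
  also have "\<dots> = (\<integral>\<^sup>+z. ennreal (normal_density 0 v z) *
      (ennreal (exp (- (t * z) / v\<^sup>2 - t\<^sup>2 / (2 * v\<^sup>2))) * f (t + z)) \<partial>lborel)"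
  proof (intro nn_integral_cong)
    fix z
    have "normal_density 0 v (t + z) = normal_density 0 v z * exp (- (t * z) / v\<^sup>2 - t\<^sup>2 / (2 * v\<^sup>2))"
      using v by (simp add: normal_density_def mult.assoc flip: exp_add)
        (simp add: field_simps power2_eq_square)
    then show "ennreal (normal_density 0 v (t + z)) * f (t + z) = ennreal (normal_density 0 v z) *
      (ennreal (exp (- (t * z) / v\<^sup>2 - t\<^sup>2 / (2 * v\<^sup>2))) * f (t + z))"
      by (simp add: ennreal_mult'' mult.assoc)
  qed
  also have "\<dots> = (\<integral>\<^sup>+z. ennreal (exp (- (t * z) / v\<^sup>2 - t\<^sup>2 / (2 * v\<^sup>2))) * f (t + z) \<partial>density lborel (normal_density 0 v))"
    by (subst nn_integral_density) auto
  finally show ?thesis ..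
qed

text \<open>
  The density of the translated Gaussian law with respect to the centred one. As both laws are
  products, it is enough to compare them on boxes, where the claim is the one-dimensional one.
\<close>

lemma nn_integral_gauss_vec_translate:
  fixes f :: "real ^ 'd \<Rightarrow> ennreal" and \<theta> :: "real ^ 'd"
  assumes v: "0 < v" and f [measurable]: "f \<in> borel_measurable borel"
  shows "(\<integral>\<^sup>+\<eta>. ennreal (exp (- (\<eta> \<bullet> \<theta>) / v\<^sup>2 - (norm \<theta>)\<^sup>2 / (2 * v\<^sup>2))) * f (\<theta> + \<eta>) \<partial>gauss_vec v)
    = (\<integral>\<^sup>+\<eta>. f \<eta> \<partial>gauss_vec v)"
proof -
  define N where "N = (\<lambda>i::'d. density lborel (normal_density 0 v))"
  have N: "prob_space (N i)" for i unfolding N_def using v by (rule prob_space_normal_density)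
  interpret product_sigma_finite N
    unfolding product_sigma_finite_def using N prob_space_imp_sigma_finite by blast
  have sN [measurable_cong, simp]: "sets (N i) = sets borel" for i by (simp add: N_def)
  have comp [measurable]: "(\<lambda>f. f i) \<in> PiM UNIV N \<rightarrow>\<^sub>M borel" for i
    using measurable_component_singleton[of i UNIV N] measurable_cong_sets[OF refl sN] by blast
  define w where "w = (\<lambda>i z. exp (- (\<theta> $ i * z) / v\<^sup>2 - (\<theta> $ i)\<^sup>2 / (2 * v\<^sup>2)))"
  define T where "T = (\<lambda>f::'d \<Rightarrow> real. \<lambda>i. \<theta> $ i + f i)"
  have w_m [measurable]: "w i \<in> borel_measurable borel" for i unfolding w_def by measurable
  have T [measurable]: "T \<in> PiM UNIV N \<rightarrow>\<^sub>M PiM UNIV N"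
  proof -
    have "(\<lambda>f. \<lambda>i\<in>UNIV. \<theta> $ i + f i) \<in> PiM UNIV N \<rightarrow>\<^sub>M PiM UNIV N"
      by (intro measurable_restrict) (simp add: measurable_cong_sets[OF refl sN])
    then show ?thesis by (simp add: T_def restrict_def)
  qed
  have vl [measurable]: "(\<lambda>f. \<chi> i. f i) \<in> PiM UNIV N \<rightarrow>\<^sub>M (borel :: (real ^ 'd) measure)"
    by (rule measurable_vec_lambda_PiM) simp
  have eq: "distr (density (PiM UNIV N) (\<lambda>f. \<Prod>i\<in>UNIV. ennreal (w i (f i)))) (PiM UNIV N) T = PiM UNIV N"
  proof (rule PiM_eqI)
    fix A :: "'d \<Rightarrow> real set" assume A: "\<And>i. i \<in> UNIV \<Longrightarrow> A i \<in> sets (N i)"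
    then have A' [measurable]: "A i \<in> sets borel" for i by simp
    have box [measurable]: "Pi\<^sub>E UNIV A \<in> sets (PiM UNIV N)" using A by (intro sets_PiM_I_finite) auto
    have "emeasure (distr (density (PiM UNIV N) (\<lambda>f. \<Prod>i\<in>UNIV. ennreal (w i (f i)))) (PiM UNIV N) T) (Pi\<^sub>E UNIV A)
      = (\<integral>\<^sup>+f. (\<Prod>i\<in>UNIV. ennreal (w i (f i))) * indicator (Pi\<^sub>E UNIV A) (T f) \<partial>PiM UNIV N)"
      by (subst emeasure_distr; simp add: emeasure_density)
         (intro nn_integral_cong, auto simp: indicator_def space_PiM T_def)
    also have "\<dots> = (\<integral>\<^sup>+f. (\<Prod>i\<in>UNIV. ennreal (w i (f i)) * indicator (A i) (\<theta> $ i + f i)) \<partial>PiM UNIV N)"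
      by (intro nn_integral_cong) (auto simp: prod.distrib T_def indicator_def PiE_iff prod_zero_iff)
    also have "\<dots> = (\<Prod>i\<in>UNIV. \<integral>\<^sup>+z. ennreal (w i z) * indicator (A i) (\<theta> $ i + z) \<partial>N i)"
    proof (rule product_nn_integral_prod)
      fix i
      have "(\<lambda>z. ennreal (w i z) * indicator (A i) (\<theta> $ i + z)) \<in> borel_measurable borel"
        by measurable
      then show "(\<lambda>z. ennreal (w i z) * indicator (A i) (\<theta> $ i + z)) \<in> borel_measurable (N i)"
        using measurable_cong_sets[OF sN refl] by blast
    qed auto
    also have "\<dots> = (\<Prod>i\<in>UNIV. emeasure (N i) (A i))"
    proof (intro prod.cong refl)
      fix i
      show "(\<integral>\<^sup>+z. ennreal (w i z) * indicator (A i) (\<theta> $ i + z) \<partial>N i) = emeasure (N i) (A i)"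
        using nn_integral_normal_translate[OF v, of "indicator (A i)" "\<theta> $ i"] A'[of i]
        by (simp add: w_def N_def)
    qed
    finally show "emeasure (distr (density (PiM UNIV N) (\<lambda>f. \<Prod>i\<in>UNIV. ennreal (w i (f i)))) (PiM UNIV N) T) (Pi\<^sub>E UNIV A)
      = (\<Prod>i\<in>UNIV. emeasure (N i) (A i))" .
  qed auto
  have "(\<integral>\<^sup>+\<eta>. f \<eta> \<partial>gauss_vec v) = (\<integral>\<^sup>+g. f (\<chi> i. g i) \<partial>PiM UNIV N)"
    unfolding gauss_vec_def N_def[symmetric] by (subst nn_integral_distr) auto
  also have "\<dots> = (\<integral>\<^sup>+g. f (\<chi> i. g i) \<partial>distr (density (PiM UNIV N) (\<lambda>f. \<Prod>i\<in>UNIV. ennreal (w i (f i)))) (PiM UNIV N) T)"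
    unfolding eq ..
  also have "\<dots> = (\<integral>\<^sup>+g. (\<Prod>i\<in>UNIV. ennreal (w i (g i))) * f (\<chi> i. T g i) \<partial>PiM UNIV N)"
  proof -
    have m: "(\<lambda>g. f (\<chi> i. g i)) \<in> borel_measurable (PiM UNIV N)" by measurable
    have m': "(\<lambda>g. f (\<chi> i. T g i)) \<in> borel_measurable (PiM UNIV N)"
      by (rule measurable_compose[OF T m])
    have "(\<integral>\<^sup>+g. f (\<chi> i. g i) \<partial>distr (density (PiM UNIV N) (\<lambda>f. \<Prod>i\<in>UNIV. ennreal (w i (f i)))) (PiM UNIV N) T)
        = (\<integral>\<^sup>+g. f (\<chi> i. T g i) \<partial>density (PiM UNIV N) (\<lambda>f. \<Prod>i\<in>UNIV. ennreal (w i (f i))))"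
      using T m by (intro nn_integral_distr) auto
    also have "\<dots> = (\<integral>\<^sup>+g. (\<Prod>i\<in>UNIV. ennreal (w i (g i))) * f (\<chi> i. T g i) \<partial>PiM UNIV N)"
      using m' by (intro nn_integral_density) auto
    finally show ?thesis .
  qed
  also have "\<dots> = (\<integral>\<^sup>+g. ennreal (exp (- ((\<chi> i. g i) \<bullet> \<theta>) / v\<^sup>2 - (norm \<theta>)\<^sup>2 / (2 * v\<^sup>2))) * f (\<theta> + (\<chi> i. g i)) \<partial>PiM UNIV N)"
  proof (intro nn_integral_cong)
    fix g :: "'d \<Rightarrow> real"
    have nt: "(norm \<theta>)\<^sup>2 = (\<Sum>i\<in>UNIV. (\<theta> $ i)\<^sup>2)"
      unfolding power2_norm_eq_inner inner_vec_def by (simp add: power2_eq_square)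
    have "(\<Prod>i\<in>UNIV. w i (g i)) = exp (- ((\<chi> i. g i) \<bullet> \<theta>) / v\<^sup>2 - (norm \<theta>)\<^sup>2 / (2 * v\<^sup>2))"
      unfolding w_def exp_sum[OF finite, symmetric] nt
      by (simp add: sum_subtractf sum_negf inner_vec_def mult.commute flip: sum_divide_distrib)
    moreover have "(\<chi> i. T g i) = \<theta> + (\<chi> i. g i)" by (simp add: T_def vec_eq_iff)
    ultimately show "(\<Prod>i\<in>UNIV. ennreal (w i (g i))) * f (\<chi> i. T g i) =
      ennreal (exp (- ((\<chi> i. g i) \<bullet> \<theta>) / v\<^sup>2 - (norm \<theta>)\<^sup>2 / (2 * v\<^sup>2))) * f (\<theta> + (\<chi> i. g i))"
      by (simp add: prod_ennreal w_def)
  qed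
  also have "\<dots> = (\<integral>\<^sup>+\<eta>. ennreal (exp (- (\<eta> \<bullet> \<theta>) / v\<^sup>2 - (norm \<theta>)\<^sup>2 / (2 * v\<^sup>2))) * f (\<theta> + \<eta>) \<partial>gauss_vec v)"
    unfolding gauss_vec_def N_def[symmetric] by (subst nn_integral_distr) auto
  finally show ?thesis ..
qed

lemma measure_gauss_vec_UNIV: "0 < v \<Longrightarrow> measure (gauss_vec v :: (real ^ 'd) measure) UNIV = 1"
  using prob_space.prob_space[OF prob_space_gauss_vec[of v]] by simp

text \<open>
  Apart from \<open>soft_clip\<close> and a logarithm, only polynomials of degree at most four in \<open>\<langle>\<eta>, x\<rangle>\<close> will
  be averaged over the perturbation, and these also serve to bound the two other averages.
\<close>

lemma gauss_vec_quartic: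
  fixes x :: "real ^ 'd"
  assumes v: "0 < v"
  defines "q \<equiv> v\<^sup>2 * (norm x)\<^sup>2"
  shows "integrable (gauss_vec v) (\<lambda>\<eta>. c0 + c1 * (\<eta> \<bullet> x) + c2 * (\<eta> \<bullet> x)\<^sup>2 + c3 * (\<eta> \<bullet> x) ^ 3 + c4 * (\<eta> \<bullet> x) ^ 4)"
    and "(\<integral>\<eta>. c0 + c1 * (\<eta> \<bullet> x) + c2 * (\<eta> \<bullet> x)\<^sup>2 + c3 * (\<eta> \<bullet> x) ^ 3 + c4 * (\<eta> \<bullet> x) ^ 4 \<partial>gauss_vec v)
      = c0 + c2 * q + c4 * (3 * q\<^sup>2)"
proof -
  interpret prob_space "gauss_vec v :: (real ^ 'd) measure" by (rule prob_space_gauss_vec[OF v])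
  note i = gauss_vec_moments(1)[OF v, of x]
  have i1: "integrable (gauss_vec v) (\<lambda>\<eta>. \<eta> \<bullet> x)" using i[of 1] by simp
  show "integrable (gauss_vec v) (\<lambda>\<eta>. c0 + c1 * (\<eta> \<bullet> x) + c2 * (\<eta> \<bullet> x)\<^sup>2 + c3 * (\<eta> \<bullet> x) ^ 3 + c4 * (\<eta> \<bullet> x) ^ 4)"
    using i i1 by (intro Bochner_Integration.integrable_add integrable_mult_right) auto
  show "(\<integral>\<eta>. c0 + c1 * (\<eta> \<bullet> x) + c2 * (\<eta> \<bullet> x)\<^sup>2 + c3 * (\<eta> \<bullet> x) ^ 3 + c4 * (\<eta> \<bullet> x) ^ 4 \<partial>gauss_vec v)
      = c0 + c2 * q + c4 * (3 * q\<^sup>2)"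
    using i i1 by (simp add: gauss_vec_moments[OF v] measure_gauss_vec_UNIV[OF v] q_def)
qed

section \<open>Perturbing the direction\<close>

text \<open>
  Averaging a concave function over a symmetric perturbation would normally lose a constant factor.
  Here the product over the pair \<open>b\<close>, \<open>- b\<close> can be minimised explicitly over \<open>b\<close>, and the minimum
  still exceeds the linear part of the value at \<open>b = 0\<close>: with \<open>u = 22 a\<^sup>2 q\<close> and \<open>A = 11 q\<^sup>2\<close> the minimum is \<open>(1 + A + u)\<^sup>2\<close> if
  \<open>u \<le> 1 + A\<close>, and \<open>4 u (1 + A)\<close> otherwise.
\<close>

lemma symmetrised_compensator_ge:
  fixes a b q :: real assumes "0 \<le> q"
  shows "1 + 44 * (a\<^sup>2 * q + q\<^sup>2 / 2) \<le>
    (1 + 22 * ((a + b)\<^sup>2 * q + q\<^sup>2 / 2)) * (1 + 22 * ((a - b)\<^sup>2 * q + q\<^sup>2 / 2))"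
proof -
  define u where "u = 22 * a\<^sup>2 * q"
  define w where "w = 22 * b\<^sup>2 * q"
  define A where "A = 11 * q\<^sup>2"
  have nn: "0 \<le> u" "0 \<le> w" "0 \<le> A" using assms by (auto simp: u_def w_def A_def)
  have eq: "(1 + 22 * ((a + b)\<^sup>2 * q + q\<^sup>2 / 2)) * (1 + 22 * ((a - b)\<^sup>2 * q + q\<^sup>2 / 2))
      = (1 + A + u + w)\<^sup>2 - 4 * u * w"
    unfolding u_def w_def A_def by (simp add: power2_eq_square algebra_simps)
  have "1 + 2 * (u + A) \<le> (1 + A + u + w)\<^sup>2 - 4 * u * w"
  proof (cases "u \<le> 1 + A")
    case True
    have "0 \<le> 2 * w * (1 + A - u)" using True nn by simp
    moreover have "0 \<le> (u + A)\<^sup>2 + w\<^sup>2" by simp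
    ultimately show ?thesis by (simp add: power2_eq_square algebra_simps)
  next
    case False
    have "0 \<le> (w + (1 + A - u))\<^sup>2" by simp
    moreover have "1 + 2 * (u + A) \<le> 4 * u * (1 + A)"
    proof -
      have "A * 1 \<le> A * u" using False nn by (intro mult_left_mono) auto
      then show ?thesis using False nn by (simp add: algebra_simps)
    qed
    ultimately show ?thesis by (simp add: power2_eq_square algebra_simps)
  qed
  then show ?thesis unfolding eq by (simp add: u_def A_def)
qed

text \<open>
  Convexity of \<open>exp\<close> reduces the claim to the point where the minimum switches. The factor \<open>44\<close>
  is large enough there; half of it is the weight of the compensating term in \<open>log_weight\<close>.
\<close>

lemma exp_min_le_linear:
  fixes y :: real assumes "0 \<le> y"
  shows "exp (2 * min (2/3 + ln 2) (4 * y)) \<le> 1 + 44 * y"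
proof -
  define b :: real where "b = 2 * (2/3 + ln 2)"
  define v where "v = min b (8 * y)"
  have b: "8/3 \<le> b" using ln2_ge_two_thirds by (simp add: b_def)
  have v: "0 \<le> v" "v \<le> b" "v \<le> 8 * y" using assms b by (auto simp: v_def)
  have "exp b = exp (1/3) ^ 4 * 4"
  proof -
    have "b = 4/3 + ln 4" using ln_realpow[of 2 2] by (simp add: b_def)
    then show ?thesis by (simp add: exp_add flip: exp_of_nat_mult)
  qed
  also have "\<dots> \<le> 1.397 ^ 4 * 4" using exp_third_le by (intro mult_right_mono power_mono) auto
  also have "\<dots> \<le> 1 + 11/2 * b" using b by (simp add: eval_nat_numeral)
  finally have eb: "exp b \<le> 1 + 11/2 * b" .
  have "exp ((1 - v / b) * 0 + (v / b) * b) \<le> (1 - v / b) * exp 0 + (v / b) * exp b"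
    using convex_onD[OF exp_convex, of "v / b" 0 b] v b by simp
  also have "\<dots> \<le> (1 - v / b) * 1 + (v / b) * (1 + 11/2 * b)"
    using eb v b by (intro add_mono mult_left_mono) auto
  also have "\<dots> = 1 + 11/2 * v" using b by (simp add: algebra_simps)
  finally have "exp v \<le> 1 + 11/2 * v" using b by simp
  also have "\<dots> \<le> 1 + 44 * y" using v by simp
  also have "v = 2 * min (2/3 + ln 2) (4 * y)" by (simp add: v_def b_def min_def)
  finally show ?thesis .
qed

text \<open>
  The sign \<open>\<delta> \<in> {1, -1}\<close> selects the direction of the deviation. Subtracting \<open>v\<^sup>2 \<parallel>x\<parallel>\<^sup>2\<close> removes the
  bias of a Gaussian perturbation of the direction: the mean over \<open>\<theta> + \<eta>\<close> is
  \<open>\<delta> (\<langle>\<theta>, x\<rangle>\<^sup>2 - l)\<close>.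
\<close>

definition pert_dev :: "real \<Rightarrow> real \<Rightarrow> real \<Rightarrow> real ^ 'd \<Rightarrow> real ^ 'd \<Rightarrow> real" where
  "pert_dev \<delta> l v \<theta> x = \<delta> * ((\<theta> \<bullet> x)\<^sup>2 - l - v\<^sup>2 * (norm x)\<^sup>2)"

text \<open>
  A quarter of the variance of \<open>pert_dev\<close> when the direction is perturbed around \<open>\<theta>\<close>.
\<close>

definition jensen_cost :: "real \<Rightarrow> real ^ 'd \<Rightarrow> real ^ 'd \<Rightarrow> real" where
  "jensen_cost v \<theta> x = (\<theta> \<bullet> x)\<^sup>2 * (v\<^sup>2 * (norm x)\<^sup>2) + (v\<^sup>2 * (norm x)\<^sup>2)\<^sup>2 / 2"

text \<open>
  The second summand compensates for the loss that \<open>soft_clip\<close> suffers from averaging over the direction.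
\<close>

definition log_weight :: "real \<Rightarrow> real \<Rightarrow> real \<Rightarrow> real ^ 'd \<Rightarrow> real ^ 'd \<Rightarrow> real" where
  "log_weight \<delta> l v \<theta> x = soft_clip (pert_dev \<delta> l v \<theta> x) + ln (1 + 22 * jensen_cost v \<theta> x)"

text \<open>
  A polynomial in \<open>x\<close> of degree four that bounds \<open>exp (log_weight \<delta> l v \<theta> x) - 1\<close>; its expectation
  therefore exists for every direction, however large.
\<close>

definition weight_excess :: "real \<Rightarrow> real \<Rightarrow> real \<Rightarrow> real ^ 'd \<Rightarrow> real ^ 'd \<Rightarrow> real" where
  "weight_excess \<delta> l v \<theta> x =
     pert_dev \<delta> l v \<theta> x + (pert_dev \<delta> l v \<theta> x)\<^sup>2 / 2 + 43 * jensen_cost v \<theta> x"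

lemma jensen_cost_nonneg: "0 \<le> jensen_cost v \<theta> x"
  by (simp add: jensen_cost_def)

text \<open>
  The boundedness of \<open>soft_clip\<close> is essential here: the compensator is multiplied by
  \<open>exp (soft_clip h) \<le> exp (2/3)\<close> only, so no moment beyond the fourth appears. The factor \<open>43\<close>
  bounds \<open>22 exp (2/3)\<close>.
\<close>

lemma exp_log_weight_le: "exp (log_weight \<delta> l v \<theta> x) \<le> 1 + weight_excess \<delta> l v \<theta> x"
proof -
  define w where "w = jensen_cost v \<theta> x"
  define h where "h = pert_dev \<delta> l v \<theta> x"
  have w: "0 \<le> w" by (simp add: w_def jensen_cost_nonneg)
  have "exp (log_weight \<delta> l v \<theta> x) = exp (soft_clip h) + exp (soft_clip h) * (22 * w)"
    using w by (simp add: log_weight_def h_def[symmetric] w_def[symmetric] exp_add algebra_simps)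
  also have "\<dots> \<le> (1 + h + h\<^sup>2 / 2) + exp (2/3) * (22 * w)"
    using w soft_clip_le[of h] by (intro add_mono exp_soft_clip_le mult_right_mono) auto
  also have "\<dots> \<le> (1 + h + h\<^sup>2 / 2) + 43 * w"
    using mult_right_mono[OF exp_two_thirds_le w] by simp
  finally show ?thesis by (simp add: weight_excess_def h_def w_def)
qed

lemma weight_excess_gauss_mean:
  fixes \<theta> x :: "real ^ 'd"
  assumes v: "0 < v" and \<delta>: "\<delta>\<^sup>2 = 1"
  defines "q \<equiv> v\<^sup>2 * (norm x)\<^sup>2" and "m \<equiv> (\<theta> \<bullet> x)\<^sup>2"
  shows "integrable (gauss_vec v) (\<lambda>\<eta>. weight_excess \<delta> l v (\<theta> + \<eta>) x)"
    and "(\<integral>\<eta>. weight_excess \<delta> l v (\<theta> + \<eta>) x \<partial>gauss_vec v)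
      = \<delta> * (m - l) + (m - l)\<^sup>2 / 2 + 45 * (m * q) + 65.5 * q\<^sup>2"
proof -
  define a where "a = \<theta> \<bullet> x"
  define D where "D = a\<^sup>2 - l - q"
  define c0 where "c0 = \<delta> * D + D\<^sup>2 / 2 + 43 * (a\<^sup>2 * q + q\<^sup>2 / 2)"
  define c1 where "c1 = 2 * a * (\<delta> + D + 43 * q)"
  define c2 where "c2 = \<delta> + D + 2 * a\<^sup>2 + 43 * q"
  define c3 where "c3 = 2 * a"
  define c4 :: real where "c4 = 1/2"
  have "weight_excess \<delta> l v (\<theta> + \<eta>) x =
      c0 + c1 * (\<eta> \<bullet> x) + c2 * (\<eta> \<bullet> x)\<^sup>2 + c3 * (\<eta> \<bullet> x) ^ 3 + c4 * (\<eta> \<bullet> x) ^ 4" for \<eta>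
  proof -
    define z where "z = \<eta> \<bullet> x"
    have "weight_excess \<delta> l v (\<theta> + \<eta>) x =
      \<delta> * ((a + z)\<^sup>2 - l - q) + \<delta>\<^sup>2 * ((a + z)\<^sup>2 - l - q)\<^sup>2 / 2 + 43 * ((a + z)\<^sup>2 * q + q\<^sup>2 / 2)"
      by (simp add: weight_excess_def pert_dev_def jensen_cost_def inner_add_left a_def z_def q_def power_mult_distrib)
    also have "\<dots> = c0 + c1 * z + c2 * z\<^sup>2 + c3 * z ^ 3 + c4 * z ^ 4"
      unfolding \<delta> c0_def c1_def c2_def c3_def c4_def D_def
      by (simp add: field_simps eval_nat_numeral)
    finally show ?thesis by (simp add: z_def)
  qed
  then have eq: "(\<lambda>\<eta>. weight_excess \<delta> l v (\<theta> + \<eta>) x) =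
    (\<lambda>\<eta>. c0 + c1 * (\<eta> \<bullet> x) + c2 * (\<eta> \<bullet> x)\<^sup>2 + c3 * (\<eta> \<bullet> x) ^ 3 + c4 * (\<eta> \<bullet> x) ^ 4)" by auto
  show "integrable (gauss_vec v) (\<lambda>\<eta>. weight_excess \<delta> l v (\<theta> + \<eta>) x)"
    unfolding eq by (rule gauss_vec_quartic(1)[OF v])
  have "(\<integral>\<eta>. weight_excess \<delta> l v (\<theta> + \<eta>) x \<partial>gauss_vec v) = c0 + c2 * q + c4 * (3 * q\<^sup>2)"
    unfolding eq q_def by (rule gauss_vec_quartic(2)[OF v])
  also have "\<dots> = \<delta> * (m - l) + (m - l)\<^sup>2 / 2 + 45 * (m * q) + 65.5 * q\<^sup>2"
    unfolding c0_def c2_def c4_def D_def m_def a_def[symmetric]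
    by (simp add: field_simps eval_nat_numeral)
  finally show "(\<integral>\<eta>. weight_excess \<delta> l v (\<theta> + \<eta>) x \<partial>gauss_vec v)
      = \<delta> * (m - l) + (m - l)\<^sup>2 / 2 + 45 * (m * q) + 65.5 * q\<^sup>2" .
qed

text \<open>
  Two bounds on the loss: semiconvexity bounds it by the variance, which is four times the Jensen cost,
  and the range \<open>[- ln 2, 2/3]\<close> of \<open>soft_clip\<close> bounds it by a constant.
\<close>

lemma soft_clip_gauss_mean_ge:
  fixes \<theta> x :: "real ^ 'd"
  assumes v: "0 < v" and \<delta>: "\<delta>\<^sup>2 = 1"
  shows "integrable (gauss_vec v) (\<lambda>\<eta>. soft_clip (pert_dev \<delta> l v (\<theta> + \<eta>) x))"
    and "soft_clip (\<delta> * ((\<theta> \<bullet> x)\<^sup>2 - l)) - min (2/3 + ln 2) (4 * jensen_cost v \<theta> x)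
      \<le> (\<integral>\<eta>. soft_clip (pert_dev \<delta> l v (\<theta> + \<eta>) x) \<partial>gauss_vec v)"
proof -
  interpret prob_space "gauss_vec v :: (real ^ 'd) measure" by (rule prob_space_gauss_vec[OF v])
  define a where "a = \<theta> \<bullet> x"
  define q where "q = v\<^sup>2 * (norm x)\<^sup>2"
  define m where "m = \<delta> * (a\<^sup>2 - l)"
  define h where "h = (\<lambda>\<eta>. pert_dev \<delta> l v (\<theta> + \<eta>) x)"
  have [measurable]: "h \<in> borel_measurable (gauss_vec v)"
    unfolding h_def pert_dev_def by measurable
  have int: "integrable (gauss_vec v) (\<lambda>\<eta>. soft_clip (h \<eta>))"
  proof (rule integrable_const_bound[of _ "max 1 (ln 2)"])
    show "AE \<eta> in gauss_vec v. norm (soft_clip (h \<eta>)) \<le> max 1 (ln 2)"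
    proof (rule AE_I2)
      fix \<eta> show "norm (soft_clip (h \<eta>)) \<le> max 1 (ln 2)"
        using soft_clip_ge[of "h \<eta>"] soft_clip_le[of "h \<eta>"] by (auto simp: abs_le_iff le_max_iff_disj)
    qed
  qed measurable
  then show "integrable (gauss_vec v) (\<lambda>\<eta>. soft_clip (pert_dev \<delta> l v (\<theta> + \<eta>) x))"
    by (simp add: h_def)
  have "- ln 2 \<le> (\<integral>\<eta>. soft_clip (h \<eta>) \<partial>gauss_vec v)"
    using integral_mono[OF _ int, of "\<lambda>_. - ln 2"] soft_clip_ge by (simp add: measure_gauss_vec_UNIV[OF v])
  then have 1: "soft_clip m - (2/3 + ln 2) \<le> (\<integral>\<eta>. soft_clip (h \<eta>) \<partial>gauss_vec v)"
    using soft_clip_le[of m] by linarith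
  \<comment> \<open>The supporting parabola at the mean is a quartic polynomial in the perturbation.\<close>
  obtain g where g: "\<And>z. soft_clip m + g * (z - m) - (z - m)\<^sup>2 \<le> soft_clip z"
    using soft_clip_semiconvex[of m] by blast
  define c0 where "c0 = soft_clip m - g * \<delta> * q - q\<^sup>2"
  define c1 where "c1 = 2 * a * g * \<delta> + 4 * a * q"
  define c2 where "c2 = g * \<delta> - 4 * a\<^sup>2 + 2 * q"
  define c3 where "c3 = - 4 * a"
  define c4 :: real where "c4 = - 1"
  have eq: "soft_clip m + g * (h \<eta> - m) - (h \<eta> - m)\<^sup>2 =
      c0 + c1 * (\<eta> \<bullet> x) + c2 * (\<eta> \<bullet> x)\<^sup>2 + c3 * (\<eta> \<bullet> x) ^ 3 + c4 * (\<eta> \<bullet> x) ^ 4" for \<eta>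
  proof -
    define z where "z = \<eta> \<bullet> x"
    have "h \<eta> - m = \<delta> * (2 * a * z + z\<^sup>2 - q)"
      by (simp add: h_def pert_dev_def inner_add_left a_def z_def q_def m_def power2_sum algebra_simps)
    then have "soft_clip m + g * (h \<eta> - m) - (h \<eta> - m)\<^sup>2
       = soft_clip m + g * (\<delta> * (2 * a * z + z\<^sup>2 - q)) - \<delta>\<^sup>2 * (2 * a * z + z\<^sup>2 - q)\<^sup>2"
      by (simp add: power_mult_distrib)
    also have "\<dots> = c0 + c1 * z + c2 * z\<^sup>2 + c3 * z ^ 3 + c4 * z ^ 4"
      unfolding \<delta> c0_def c1_def c2_def c3_def c4_def
      by (simp add: algebra_simps eval_nat_numeral)
    finally show ?thesis by (simp add: z_def)
  qed
  have "soft_clip m - 4 * jensen_cost v \<theta> x = c0 + c2 * q + c4 * (3 * q\<^sup>2)"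
    unfolding jensen_cost_def q_def[symmetric] a_def[symmetric] c0_def c2_def c4_def
    by (simp add: algebra_simps power2_eq_square)
  also have "\<dots> = (\<integral>\<eta>. soft_clip m + g * (h \<eta> - m) - (h \<eta> - m)\<^sup>2 \<partial>gauss_vec v)"
    unfolding eq q_def by (rule gauss_vec_quartic(2)[OF v, symmetric])
  also have "\<dots> \<le> (\<integral>\<eta>. soft_clip (h \<eta>) \<partial>gauss_vec v)"
  proof (rule integral_mono[OF _ int])
    show "integrable (gauss_vec v) (\<lambda>\<eta>. soft_clip m + g * (h \<eta> - m) - (h \<eta> - m)\<^sup>2)"
      unfolding eq by (rule gauss_vec_quartic(1)[OF v])
  qed (rule g)
  finally have 2: "soft_clip m - 4 * jensen_cost v \<theta> x \<le> (\<integral>\<eta>. soft_clip (h \<eta>) \<partial>gauss_vec v)" .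
  show "soft_clip (\<delta> * ((\<theta> \<bullet> x)\<^sup>2 - l)) - min (2/3 + ln 2) (4 * jensen_cost v \<theta> x)
      \<le> (\<integral>\<eta>. soft_clip (pert_dev \<delta> l v (\<theta> + \<eta>) x) \<partial>gauss_vec v)"
    using 1 2 unfolding h_def m_def a_def by (simp add: min_def)
qed

text \<open>
  The law of \<open>\<eta>\<close> is symmetric, so the integrand may be averaged over \<open>\<eta>\<close> and \<open>- \<eta>\<close>; the resulting
  sum of two logarithms is bounded below for each \<open>\<eta>\<close> separately.
\<close>

lemma compensator_gauss_mean_ge:
  fixes \<theta> x :: "real ^ 'd"
  assumes v: "0 < v"
  shows "integrable (gauss_vec v) (\<lambda>\<eta>. ln (1 + 22 * jensen_cost v (\<theta> + \<eta>) x))"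
    and "min (2/3 + ln 2) (4 * jensen_cost v \<theta> x)
      \<le> (\<integral>\<eta>. ln (1 + 22 * jensen_cost v (\<theta> + \<eta>) x) \<partial>gauss_vec v)"
proof -
  interpret prob_space "gauss_vec v :: (real ^ 'd) measure" by (rule prob_space_gauss_vec[OF v])
  define a where "a = \<theta> \<bullet> x"
  define q where "q = v\<^sup>2 * (norm x)\<^sup>2"
  have q: "0 \<le> q" by (simp add: q_def)
  define f where "f = (\<lambda>z. ln (1 + 22 * ((a + z)\<^sup>2 * q + q\<^sup>2 / 2)))"
  have [measurable]: "f \<in> borel_measurable borel" unfolding f_def by measurable
  have feq: "(\<lambda>\<eta>. ln (1 + 22 * jensen_cost v (\<theta> + \<eta>) x)) = (\<lambda>\<eta>. f (\<eta> \<bullet> x))"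
    by (simp add: f_def jensen_cost_def a_def q_def inner_add_left)
  have f_bounds: "0 \<le> f z" "f z \<le> 22 * ((a + z)\<^sup>2 * q + q\<^sup>2 / 2)" for z
  proof -
    have "0 \<le> 22 * ((a + z)\<^sup>2 * q + q\<^sup>2 / 2)" using q by simp
    then show "0 \<le> f z" "f z \<le> 22 * ((a + z)\<^sup>2 * q + q\<^sup>2 / 2)"
      unfolding f_def by (auto intro!: ln_add_one_self_le_self)
  qed
  have int: "integrable (gauss_vec v) (\<lambda>\<eta>. f (s * (\<eta> \<bullet> x)))" if s: "s = 1 \<or> s = -1" for s
  proof (rule Bochner_Integration.integrable_bound)
    show "integrable (gauss_vec v) (\<lambda>\<eta>. 22 * (a\<^sup>2 * q + q\<^sup>2 / 2) + (44 * s * a * q) * (\<eta> \<bullet> x) + (22 * q) * (\<eta> \<bullet> x)\<^sup>2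
        + 0 * (\<eta> \<bullet> x) ^ 3 + 0 * (\<eta> \<bullet> x) ^ 4)"
      by (rule gauss_vec_quartic(1)[OF v])
    show "AE \<eta> in gauss_vec v. norm (f (s * (\<eta> \<bullet> x))) \<le> norm (22 * (a\<^sup>2 * q + q\<^sup>2 / 2) + (44 * s * a * q) * (\<eta> \<bullet> x) + (22 * q) * (\<eta> \<bullet> x)\<^sup>2
        + 0 * (\<eta> \<bullet> x) ^ 3 + 0 * (\<eta> \<bullet> x) ^ 4)"
    proof (rule AE_I2)
      fix \<eta> :: "real ^ 'd"
      have "22 * ((a + s * (\<eta> \<bullet> x))\<^sup>2 * q + q\<^sup>2 / 2) = 22 * (a\<^sup>2 * q + q\<^sup>2 / 2) + (44 * s * a * q) * (\<eta> \<bullet> x) + (22 * q) * (\<eta> \<bullet> x)\<^sup>2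
        + 0 * (\<eta> \<bullet> x) ^ 3 + 0 * (\<eta> \<bullet> x) ^ 4"
        using s by (auto simp: power2_eq_square algebra_simps)
      then show "norm (f (s * (\<eta> \<bullet> x))) \<le> norm (22 * (a\<^sup>2 * q + q\<^sup>2 / 2) + (44 * s * a * q) * (\<eta> \<bullet> x) + (22 * q) * (\<eta> \<bullet> x)\<^sup>2
        + 0 * (\<eta> \<bullet> x) ^ 3 + 0 * (\<eta> \<bullet> x) ^ 4)"
        using f_bounds[of "s * (\<eta> \<bullet> x)"] by simp
    qed
  qed measurable
  show "integrable (gauss_vec v) (\<lambda>\<eta>. ln (1 + 22 * jensen_cost v (\<theta> + \<eta>) x))"
    unfolding feq using int[of 1] by simp
  define c where "c = min (2/3 + ln 2) (4 * jensen_cost v \<theta> x)"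
  have pair: "2 * c \<le> f z + f (- z)" for z
  proof -
    have pos: "0 < 1 + 22 * ((a + z)\<^sup>2 * q + q\<^sup>2 / 2)" for z
      using q by (intro add_pos_nonneg) auto
    have "exp (2 * c) \<le> 1 + 44 * (a\<^sup>2 * q + q\<^sup>2 / 2)"
      unfolding c_def using exp_min_le_linear[OF jensen_cost_nonneg, of v \<theta> x]
      by (simp add: jensen_cost_def a_def q_def)
    also have "\<dots> \<le> (1 + 22 * ((a + z)\<^sup>2 * q + q\<^sup>2 / 2)) * (1 + 22 * ((a - z)\<^sup>2 * q + q\<^sup>2 / 2))"
      by (rule symmetrised_compensator_ge[OF q])
    finally have "2 * c \<le> ln ((1 + 22 * ((a + z)\<^sup>2 * q + q\<^sup>2 / 2)) * (1 + 22 * ((a - z)\<^sup>2 * q + q\<^sup>2 / 2)))"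
      using pos[of z] pos[of "- z"] by (subst ln_ge_iff) auto
    also have "\<dots> = f z + f (- z)"
      using pos[of z] pos[of "- z"] by (simp add: f_def ln_mult)
    finally show ?thesis .
  qed
  have "2 * c \<le> (\<integral>\<eta>. f (\<eta> \<bullet> x) + f (- (\<eta> \<bullet> x)) \<partial>gauss_vec v)"
    using integral_mono[of "gauss_vec v" "\<lambda>_. 2 * c" "\<lambda>\<eta>. f (\<eta> \<bullet> x) + f (- (\<eta> \<bullet> x))"] int[of 1] int[of "-1"] pair
    by (simp add: measure_gauss_vec_UNIV[OF v])
  also have "\<dots> = (\<integral>\<eta>. f (\<eta> \<bullet> x) \<partial>gauss_vec v) + (\<integral>\<eta>. f (- (\<eta> \<bullet> x)) \<partial>gauss_vec v)"
    using int[of 1] int[of "-1"] by (intro Bochner_Integration.integral_add) auto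
  also have "\<dots> = 2 * (\<integral>\<eta>. f (\<eta> \<bullet> x) \<partial>gauss_vec v)"
    using gauss_vec_symmetric[OF v, of f x] by simp
  finally show "min (2/3 + ln 2) (4 * jensen_cost v \<theta> x)
      \<le> (\<integral>\<eta>. ln (1 + 22 * jensen_cost v (\<theta> + \<eta>) x) \<partial>gauss_vec v)"
    unfolding feq by (simp add: c_def)
qed

lemma log_weight_gauss_mean_ge:
  fixes \<theta> x :: "real ^ 'd"
  assumes v: "0 < v" and \<delta>: "\<delta>\<^sup>2 = 1"
  shows "integrable (gauss_vec v) (\<lambda>\<eta>. log_weight \<delta> l v (\<theta> + \<eta>) x)"
    and "soft_clip (\<delta> * ((\<theta> \<bullet> x)\<^sup>2 - l)) \<le> (\<integral>\<eta>. log_weight \<delta> l v (\<theta> + \<eta>) x \<partial>gauss_vec v)"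
  unfolding log_weight_def
  using soft_clip_gauss_mean_ge[OF v \<delta>, where l=l and \<theta>=\<theta> and x=x]
    compensator_gauss_mean_ge[OF v, where \<theta>=\<theta> and x=x]
  by simp_all

section \<open>The PAC-Bayesian inequality with Gaussian posteriors\<close>

text \<open>
  Jensen's inequality from the tangent of \<open>exp\<close> at the mean, in a form that admits an infinite
  right-hand side.
\<close>

lemma exp_integral_le_nn_integral_exp:
  fixes G :: "'a \<Rightarrow> real"
  assumes "prob_space Q" and G: "integrable Q G"
  shows "ennreal (exp (\<integral>x. G x \<partial>Q)) \<le> (\<integral>\<^sup>+x. ennreal (exp (G x)) \<partial>Q)"
proof (cases "(\<integral>\<^sup>+x. ennreal (exp (G x)) \<partial>Q) = \<infinity>")
  case False
  interpret prob_space Q by fact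
  have [measurable]: "G \<in> borel_measurable Q" using G by simp
  have ie: "integrable Q (\<lambda>x. exp (G x))"
    using False by (intro integrableI_nonneg) (auto simp: less_top)
  define m where "m = (\<integral>x. G x \<partial>Q)"
  have "exp m = (\<integral>x. exp m * (1 + (G x - m)) \<partial>Q)"
    using G by (simp add: prob_space m_def)
  also have "\<dots> \<le> (\<integral>x. exp (G x) \<partial>Q)"
  proof (rule integral_mono[OF _ ie])
    fix x
    have "exp m * (1 + (G x - m)) \<le> exp m * exp (G x - m)"
      by (intro mult_left_mono exp_ge_add_one_self) auto
    then show "exp m * (1 + (G x - m)) \<le> exp (G x)" by (simp flip: exp_add)
  qed (use G in auto)
  finally show ?thesis using ie by (simp add: nn_integral_eq_integral m_def)
qed simp

text \<open>
  Integrated over the centred Gaussian prior, the exponential of the centred empirical process has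
  expectation at most \<open>1\<close>, so Markov's inequality gives one event that does not depend on the
  direction. On this event, rewriting the prior integral as an integral over \<open>\<theta> + \<eta>\<close> and applying
  Jensen's inequality gives the claim for every \<open>\<theta>\<close>. The term
  \<open>\<parallel>\<theta>\<parallel>\<^sup>2 / (2 v\<^sup>2)\<close> is the Kullback divergence between the two Gaussian laws.
\<close>

lemma pac_bayes_gauss:
  fixes \<phi> :: "real ^ 'd \<Rightarrow> 'b \<Rightarrow> real" and J :: "real ^ 'd \<Rightarrow> real"
  assumes M: "prob_space M" and I: "finite I"
    and indep: "prob_space.indep_vars M (\<lambda>_. S) X I"
    and law: "\<And>i. i \<in> I \<Longrightarrow> distr M S (X i) = P" and S: "sets P = sets S"
    and v: "0 < v" and e: "0 < e"
    and \<phi> [measurable]: "(\<lambda>(\<theta>, x). \<phi> \<theta> x) \<in> borel_measurable (borel \<Otimes>\<^sub>M S)"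
    and J [measurable]: "J \<in> borel_measurable borel"
    and le: "\<And>\<theta>. (\<integral>\<^sup>+x. ennreal (exp (\<phi> \<theta> x)) \<partial>P) \<le> ennreal (exp (J \<theta>))"
    and int_\<phi>: "\<And>\<theta> x. integrable (gauss_vec v) (\<lambda>\<eta>. \<phi> (\<theta> + \<eta>) x)"
    and int_J: "\<And>\<theta>. integrable (gauss_vec v) (\<lambda>\<eta>. J (\<theta> + \<eta>))"
  shows "\<exists>A \<in> sets M. measure M A \<ge> 1 - e \<and> (\<forall>\<omega> \<in> A. \<forall>\<theta>.
    (\<Sum>i\<in>I. \<integral>\<eta>. \<phi> (\<theta> + \<eta>) (X i \<omega>) \<partial>gauss_vec v)
      \<le> real (card I) * (\<integral>\<eta>. J (\<theta> + \<eta>) \<partial>gauss_vec v) + (norm \<theta>)\<^sup>2 / (2 * v\<^sup>2) + ln (1 / e))"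
proof -
  interpret M: prob_space M by fact
  interpret G: prob_space "gauss_vec v :: (real ^ 'd) measure" by (rule prob_space_gauss_vec[OF v])
  interpret MG: pair_sigma_finite M "gauss_vec v :: (real ^ 'd) measure" by unfold_locales
  have X: "X i \<in> M \<rightarrow>\<^sub>M S" if "i \<in> I" for i using indep that by (simp add: M.indep_vars_def)
  define F where "F = (\<lambda>\<theta> \<omega>. (\<Sum>i\<in>I. \<phi> \<theta> (X i \<omega>)) - real (card I) * J \<theta>)"
  have \<phi>X: "(\<lambda>(\<omega>, \<theta>). \<phi> \<theta> (X i \<omega>)) \<in> borel_measurable (M \<Otimes>\<^sub>M gauss_vec v)" if "i \<in> I" for i
  proof -
    have [measurable]: "X i \<in> M \<rightarrow>\<^sub>M S" by (rule X[OF that])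
    have "(\<lambda>p. (\<lambda>(\<theta>, x). \<phi> \<theta> x) (snd p, X i (fst p))) \<in> borel_measurable (M \<Otimes>\<^sub>M gauss_vec v)"
      by measurable
    then show ?thesis by (simp add: case_prod_beta)
  qed
  have Fm [measurable]: "(\<lambda>(\<omega>, \<theta>). F \<theta> \<omega>) \<in> borel_measurable (M \<Otimes>\<^sub>M gauss_vec v)"
    using \<phi>X unfolding F_def case_prod_beta
    by (intro borel_measurable_diff borel_measurable_sum) (auto simp: case_prod_beta)
  \<comment> \<open>The prior average of the exponential process; the event is where it stays below 1 / e.\<close>
  define W where "W = (\<lambda>\<omega>. \<integral>\<^sup>+\<theta>. ennreal (exp (F \<theta> \<omega>)) \<partial>gauss_vec v)"
  have Wm [measurable]: "W \<in> borel_measurable M"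
    unfolding W_def by measurable
  have inner: "(\<integral>\<^sup>+\<omega>. ennreal (exp (F \<theta> \<omega>)) \<partial>M) \<le> 1" for \<theta>
  proof -
    have \<phi>\<theta>: "(\<lambda>x. exp (\<phi> \<theta> x)) \<in> borel_measurable S"
      using measurable_Pair2[OF \<phi>, of \<theta>] by simp
    have ind: "M.indep_vars (\<lambda>_. borel) (\<lambda>i \<omega>. ennreal (exp (\<phi> \<theta> (X i \<omega>)))) I"
      by (rule M.indep_vars_compose2[OF indep]) (use \<phi>\<theta> in simp)
    have "(\<integral>\<^sup>+\<omega>. ennreal (exp (F \<theta> \<omega>)) \<partial>M)
      = (\<integral>\<^sup>+\<omega>. (\<Prod>i\<in>I. ennreal (exp (\<phi> \<theta> (X i \<omega>)))) * ennreal (exp (- real (card I) * J \<theta>)) \<partial>M)"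
      by (intro nn_integral_cong)
        (simp add: F_def exp_diff exp_sum[OF I] prod_ennreal exp_minus divide_inverse flip: ennreal_mult'')
    also have "\<dots> = (\<integral>\<^sup>+\<omega>. (\<Prod>i\<in>I. ennreal (exp (\<phi> \<theta> (X i \<omega>)))) \<partial>M) * ennreal (exp (- real (card I) * J \<theta>))"
      using ind by (intro nn_integral_multc borel_measurable_prod_ennreal) (auto simp: M.indep_vars_def)
    also have "(\<integral>\<^sup>+\<omega>. (\<Prod>i\<in>I. ennreal (exp (\<phi> \<theta> (X i \<omega>)))) \<partial>M)
      = (\<Prod>i\<in>I. \<integral>\<^sup>+\<omega>. ennreal (exp (\<phi> \<theta> (X i \<omega>))) \<partial>M)"
      by (rule M.indep_vars_nn_integral[OF I ind]) simp
    also have "\<dots> \<le> (\<Prod>i\<in>I. ennreal (exp (J \<theta>)))"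
    proof -
      have each: "(\<integral>\<^sup>+\<omega>. ennreal (exp (\<phi> \<theta> (X i \<omega>))) \<partial>M) \<le> ennreal (exp (J \<theta>))" if i: "i \<in> I" for i
      proof -
        have "(\<integral>\<^sup>+\<omega>. ennreal (exp (\<phi> \<theta> (X i \<omega>))) \<partial>M) = (\<integral>\<^sup>+x. ennreal (exp (\<phi> \<theta> x)) \<partial>distr M S (X i))"
          using X[OF i] \<phi>\<theta> by (subst nn_integral_distr) auto
        then show ?thesis using le[of \<theta>] law[OF i] by simp
      qed
      show ?thesis by (intro prod_mono_ennreal each)
    qed
    also have "(\<Prod>i\<in>I. ennreal (exp (J \<theta>))) * ennreal (exp (- real (card I) * J \<theta>)) = 1"
      by (simp add: ennreal_power flip: ennreal_mult'' exp_of_nat_mult exp_add)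
    finally show ?thesis by (simp add: mult_right_mono)
  qed
  have "(\<integral>\<^sup>+\<omega>. W \<omega> \<partial>M) = (\<integral>\<^sup>+\<theta>. \<integral>\<^sup>+\<omega>. ennreal (exp (F \<theta> \<omega>)) \<partial>M \<partial>gauss_vec v)"
    unfolding W_def by (rule MG.Fubini'[symmetric]) measurable
  also have "\<dots> \<le> (\<integral>\<^sup>+\<theta>. 1 \<partial>(gauss_vec v :: (real ^ 'd) measure))"
    by (intro nn_integral_mono inner)
  also have "\<dots> = 1" using G.emeasure_space_1 by simp
  finally have W1: "(\<integral>\<^sup>+\<omega>. W \<omega> \<partial>M) \<le> 1" .
  define Bad where "Bad = {\<omega> \<in> space M. 1 \<le> ennreal e * W \<omega>}"
  have Bad [measurable]: "Bad \<in> sets M" unfolding Bad_def by measurable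
  have "emeasure M Bad \<le> ennreal e * (\<integral>\<^sup>+\<omega>. W \<omega> * indicator (space M) \<omega> \<partial>M)"
    unfolding Bad_def by (rule nn_integral_Markov_inequality) auto
  also have "(\<integral>\<^sup>+\<omega>. W \<omega> * indicator (space M) \<omega> \<partial>M) = (\<integral>\<^sup>+\<omega>. W \<omega> \<partial>M)"
    by (intro nn_integral_cong) auto
  also have "ennreal e * \<dots> \<le> ennreal e * 1" by (intro mult_left_mono W1) auto
  finally have "measure M Bad \<le> e"
    using e by (simp add: M.emeasure_eq_measure)
  then have meas: "1 - e \<le> measure M (space M - Bad)"
    by (subst M.prob_compl) auto
  have "(\<Sum>i\<in>I. \<integral>\<eta>. \<phi> (\<theta> + \<eta>) (X i \<omega>) \<partial>gauss_vec v)
      \<le> real (card I) * (\<integral>\<eta>. J (\<theta> + \<eta>) \<partial>gauss_vec v) + (norm \<theta>)\<^sup>2 / (2 * v\<^sup>2) + ln (1 / e)"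
    if \<omega>: "\<omega> \<in> space M - Bad" for \<omega> \<theta>
  proof -
    define H where "H = (\<lambda>\<eta>. - (\<eta> \<bullet> \<theta>) / v\<^sup>2 - (norm \<theta>)\<^sup>2 / (2 * v\<^sup>2) + F (\<theta> + \<eta>) \<omega>)"
    have i1: "integrable (gauss_vec v) (\<lambda>\<eta>. \<eta> \<bullet> \<theta>)" using gauss_vec_moments(1)[OF v, of \<theta> 1] by simp
    have iF: "integrable (gauss_vec v) (\<lambda>\<eta>. F (\<theta> + \<eta>) \<omega>)"
      unfolding F_def using int_\<phi> int_J by (intro Bochner_Integration.integrable_diff Bochner_Integration.integrable_sum integrable_mult_right) auto
    have iH: "integrable (gauss_vec v) H"
      unfolding H_def using i1 iF by (intro Bochner_Integration.integrable_add Bochner_Integration.integrable_diff) auto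
    have "(\<integral>\<eta>. H \<eta> \<partial>gauss_vec v) = - (norm \<theta>)\<^sup>2 / (2 * v\<^sup>2) + (\<integral>\<eta>. F (\<theta> + \<eta>) \<omega> \<partial>gauss_vec v)"
      unfolding H_def using i1 iF by (simp add: gauss_vec_moments(2)[OF v] measure_gauss_vec_UNIV[OF v])
    also have "(\<integral>\<eta>. F (\<theta> + \<eta>) \<omega> \<partial>gauss_vec v) =
      (\<Sum>i\<in>I. \<integral>\<eta>. \<phi> (\<theta> + \<eta>) (X i \<omega>) \<partial>gauss_vec v) - real (card I) * (\<integral>\<eta>. J (\<theta> + \<eta>) \<partial>gauss_vec v)"
      unfolding F_def using int_\<phi> int_J by simp
    finally have eqH: "(\<integral>\<eta>. H \<eta> \<partial>gauss_vec v) = - (norm \<theta>)\<^sup>2 / (2 * v\<^sup>2) +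
      ((\<Sum>i\<in>I. \<integral>\<eta>. \<phi> (\<theta> + \<eta>) (X i \<omega>) \<partial>gauss_vec v) - real (card I) * (\<integral>\<eta>. J (\<theta> + \<eta>) \<partial>gauss_vec v))" .
    have F\<omega>: "(\<lambda>\<theta>. F \<theta> \<omega>) \<in> borel_measurable borel"
    proof -
      have "(\<lambda>\<theta>. F \<theta> \<omega>) \<in> borel_measurable (gauss_vec v)"
        using measurable_Pair2[OF Fm, of \<omega>] \<omega> by simp
      then show ?thesis by (simp add: measurable_cong_sets[OF sets_gauss_vec refl])
    qed
    have "ennreal (exp (\<integral>\<eta>. H \<eta> \<partial>gauss_vec v)) \<le> (\<integral>\<^sup>+\<eta>. ennreal (exp (H \<eta>)) \<partial>gauss_vec v)"
      by (rule exp_integral_le_nn_integral_exp[OF prob_space_gauss_vec[OF v] iH])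
    also have "\<dots> = (\<integral>\<^sup>+\<eta>. ennreal (exp (- (\<eta> \<bullet> \<theta>) / v\<^sup>2 - (norm \<theta>)\<^sup>2 / (2 * v\<^sup>2))) * ennreal (exp (F (\<theta> + \<eta>) \<omega>)) \<partial>gauss_vec v)"
      by (intro nn_integral_cong) (simp add: H_def exp_add flip: ennreal_mult'')
    also have "\<dots> = W \<omega>"
      unfolding W_def using F\<omega> by (intro nn_integral_gauss_vec_translate[OF v]) auto
    finally have "ennreal e * ennreal (exp (\<integral>\<eta>. H \<eta> \<partial>gauss_vec v)) \<le> ennreal e * W \<omega>"
      by (intro mult_left_mono) auto
    also have "\<dots> < 1" using \<omega> by (auto simp: Bad_def not_le)
    finally have "e * exp (\<integral>\<eta>. H \<eta> \<partial>gauss_vec v) < 1"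
      using e by (simp add: ennreal_less_one_iff flip: ennreal_mult'')
    then have "exp (\<integral>\<eta>. H \<eta> \<partial>gauss_vec v) < 1 / e" using e by (simp add: field_simps)
    then have "(\<integral>\<eta>. H \<eta> \<partial>gauss_vec v) < ln (1 / e)" using e by (metis exp_gt_zero ln_exp ln_less_cancel_iff zero_less_divide_1_iff)
    then show ?thesis unfolding eqH by simp
  qed
  then show ?thesis using meas Bad by (intro bexI[of _ "space M - Bad"]) auto
qed

section \<open>Fourth moments and the kurtosis\<close>

text \<open>
  The quadratic polynomial \<open>\<integral> (t f - g)\<^sup>2\<close> in \<open>t\<close> is nonnegative, hence its discriminant is not positive.
\<close>

lemma integral_mult_square_le:
  fixes f g :: "'a \<Rightarrow> real"
  assumes f: "integrable M (\<lambda>x. (f x)\<^sup>2)" and g: "integrable M (\<lambda>x. (g x)\<^sup>2)"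
    and fg: "integrable M (\<lambda>x. f x * g x)"
  shows "(\<integral>x. f x * g x \<partial>M)\<^sup>2 \<le> (\<integral>x. (f x)\<^sup>2 \<partial>M) * (\<integral>x. (g x)\<^sup>2 \<partial>M)"
proof -
  define A where "A = (\<integral>x. (f x)\<^sup>2 \<partial>M)"
  define B where "B = (\<integral>x. f x * g x \<partial>M)"
  define C where "C = (\<integral>x. (g x)\<^sup>2 \<partial>M)"
  have q: "0 \<le> t\<^sup>2 * A - 2 * t * B + C" for t
  proof -
    have "0 \<le> (\<integral>x. (t * f x - g x)\<^sup>2 \<partial>M)" by simp
    also have "(\<lambda>x. (t * f x - g x)\<^sup>2) = (\<lambda>x. t\<^sup>2 * (f x)\<^sup>2 - (2 * t) * (f x * g x) + (g x)\<^sup>2)"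
      by (simp add: power2_eq_square algebra_simps)
    also have "(\<integral>x. t\<^sup>2 * (f x)\<^sup>2 - (2 * t) * (f x * g x) + (g x)\<^sup>2 \<partial>M) = t\<^sup>2 * A - 2 * t * B + C"
      using f g fg by (simp add: A_def B_def C_def)
    finally show ?thesis .
  qed
  have A: "0 \<le> A" unfolding A_def by simp
  have "B\<^sup>2 \<le> A * C"
  proof (cases "A = 0")
    case True
    then have "B = 0" using q[of "(C + 1) / (2 * B)"] by (cases "B = 0") auto
    then show ?thesis using True by simp
  next
    case False
    have "(B / A)\<^sup>2 * A - 2 * (B / A) * B = - (B\<^sup>2 / A)"
      using False by (simp add: power2_eq_square)
    then have "B\<^sup>2 / A \<le> C" using q[of "B / A"] by linarith
    then show ?thesis using False A by (simp add: pos_divide_le_eq mult.commute)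
  qed
  then show ?thesis by (simp add: A_def B_def C_def)
qed

locale fourth_moment =
  fixes P :: "(real ^ 'd) measure"
  assumes prob: "prob_space P" and sets_P [simp, measurable_cong]: "sets P = sets borel"
    and moment: "integrable P (\<lambda>x. norm x ^ 4)"
begin

text \<open>
  The scale \<open>E (\<parallel>X\<parallel>\<^sup>4)\<^bsup>1/2\<^esup>\<close> takes the place of the trace of the Gram matrix in the moment bounds;
  under a kurtosis bound it lies between the trace and \<open>sqrt \<kappa>\<close> times the trace.
\<close>

definition "s4 = sqrt (\<integral>x. norm x ^ 4 \<partial>P)"

sublocale prob_space P by (rule prob)

lemma s4_sq: "s4\<^sup>2 = (\<integral>x. norm x ^ 4 \<partial>P)" and s4_nonneg: "0 \<le> s4"
  by (simp_all add: s4_def)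

lemma integrable_of_quartic_bound:
  assumes [measurable]: "f \<in> borel_measurable borel" and "\<And>x. \<bar>f x\<bar> \<le> c * (1 + norm x ^ 4)"
  shows "integrable P (f :: real ^ 'd \<Rightarrow> real)"
proof (rule Bochner_Integration.integrable_bound)
  show "integrable P (\<lambda>x. c * (1 + norm x ^ 4))" using moment by simp
  show "AE x in P. norm (f x) \<le> norm (c * (1 + norm x ^ 4))"
    using assms(2) by (intro AE_I2) (metis abs_ge_self order_trans real_norm_def)
qed measurable

lemma power2_le_one_plus_power4: "(a::real)\<^sup>2 \<le> 1 + a ^ 4"
proof -
  have "0 \<le> (a\<^sup>2 - 1)\<^sup>2 + a ^ 4 + 1" by simp
  moreover have "(a\<^sup>2 - 1)\<^sup>2 = a ^ 4 - 2 * a\<^sup>2 + 1" by (simp add: power2_diff flip: power_mult)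
  ultimately show ?thesis by linarith
qed

lemma inner_power2_le: "(\<theta> \<bullet> x)\<^sup>2 \<le> (norm \<theta>)\<^sup>2 * (norm x)\<^sup>2" for \<theta> x :: "real ^ 'd"
  using Cauchy_Schwarz_ineq[of \<theta> x] by (simp add: power2_norm_eq_inner)

lemma moment2: "integrable P (\<lambda>x. (norm x)\<^sup>2)"
  by (rule integrable_of_quartic_bound[where c=1]) (auto simp: power2_le_one_plus_power4)

lemma moment_inner2: "integrable P (\<lambda>x. (\<theta> \<bullet> x)\<^sup>2)"
proof (rule integrable_of_quartic_bound[where c="(norm \<theta>)\<^sup>2"])
  fix x show "\<bar>(\<theta> \<bullet> x)\<^sup>2\<bar> \<le> (norm \<theta>)\<^sup>2 * (1 + norm x ^ 4)"
    using inner_power2_le[of \<theta> x] mult_left_mono[OF power2_le_one_plus_power4[of "norm x"], of "(norm \<theta>)\<^sup>2"]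
    by simp
qed measurable

lemma moment_inner4: "integrable P (\<lambda>x. (\<theta> \<bullet> x) ^ 4)"
proof (rule integrable_of_quartic_bound[where c="norm \<theta> ^ 4"])
  fix x
  have "((\<theta> \<bullet> x)\<^sup>2)\<^sup>2 \<le> ((norm \<theta>)\<^sup>2 * (norm x)\<^sup>2)\<^sup>2" by (intro power_mono inner_power2_le) auto
  also have "\<dots> \<le> norm \<theta> ^ 4 * (1 + norm x ^ 4)" by (simp add: power_mult_distrib algebra_simps flip: power_mult)
  finally show "\<bar>(\<theta> \<bullet> x) ^ 4\<bar> \<le> norm \<theta> ^ 4 * (1 + norm x ^ 4)" by (simp flip: power_mult)
qed measurable

lemma moment_mixed: "integrable P (\<lambda>x. (\<theta> \<bullet> x)\<^sup>2 * (norm x)\<^sup>2)"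
proof (rule integrable_of_quartic_bound[where c="(norm \<theta>)\<^sup>2"])
  fix x
  have "(\<theta> \<bullet> x)\<^sup>2 * (norm x)\<^sup>2 \<le> ((norm \<theta>)\<^sup>2 * (norm x)\<^sup>2) * (norm x)\<^sup>2"
    by (intro mult_right_mono inner_power2_le) auto
  also have "\<dots> \<le> (norm \<theta>)\<^sup>2 * (1 + norm x ^ 4)" by (simp add: algebra_simps flip: power_add)
  finally show "\<bar>(\<theta> \<bullet> x)\<^sup>2 * (norm x)\<^sup>2\<bar> \<le> (norm \<theta>)\<^sup>2 * (1 + norm x ^ 4)" by simp
qed measurable

lemma quad_form_nonneg: "0 \<le> quad_form P \<theta>"
  by (simp add: quad_form_def)

lemma quad_form_scale: "quad_form P (a *\<^sub>R \<theta>) = a\<^sup>2 * quad_form P \<theta>"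
  by (simp add: quad_form_def power_mult_distrib)

text \<open>
  The trace is a bounded linear functional of the matrix and commutes with its integral.
\<close>

lemma trace_gram: "trace (gram P) = (\<integral>x. (norm x)\<^sup>2 \<partial>P)"
proof -
  have int: "integrable P (\<lambda>x. (\<chi> i j. x $ i * x $ j) :: real ^ 'd ^ 'd)"
  proof (rule Bochner_Integration.integrable_bound[OF moment2])
    show "(\<lambda>x. (\<chi> i j. x $ i * x $ j) :: real ^ 'd ^ 'd) \<in> borel_measurable P"
      unfolding measurable_cong_sets[OF sets_P refl]
      by (intro borel_measurable_continuous_onI continuous_on_vec_lambda continuous_intros)
    show "AE x in P. norm ((\<chi> i j. x $ i * x $ j) :: real ^ 'd ^ 'd) \<le> norm ((norm x)\<^sup>2)"
    proof (rule AE_I2)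
      fix x :: "real ^ 'd"
      have "(\<chi> i j. x $ i * x $ j) = (\<chi> i. x $ i *\<^sub>R x)" by (simp add: vec_eq_iff)
      moreover have "norm (\<chi> i. x $ i *\<^sub>R x) = norm x * norm x"
        by (simp add: norm_vec_def[of "\<chi> i. x $ i *\<^sub>R x"] L2_set_def power_mult_distrib flip: sum_distrib_right)
          (simp add: real_sqrt_mult norm_vec_def L2_set_def sum_nonneg)
      ultimately show "norm ((\<chi> i j. x $ i * x $ j) :: real ^ 'd ^ 'd) \<le> norm ((norm x)\<^sup>2)"
        by (simp add: power2_eq_square)
    qed
  qed
  have bl: "bounded_linear (trace :: real ^ 'd ^ 'd \<Rightarrow> real)"
    by (rule linear_conv_bounded_linear[THEN iffD1])
       (auto intro!: linearI simp: trace_def sum_distrib_left sum.distrib)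
  have "trace (gram P) = (\<integral>x. trace ((\<chi> i j. x $ i * x $ j) :: real ^ 'd ^ 'd) \<partial>P)"
    unfolding gram_def by (rule integral_bounded_linear[OF bl int, symmetric])
  also have "\<dots> = (\<integral>x. (norm x)\<^sup>2 \<partial>P)"
    by (simp add: trace_def power2_norm_eq_inner inner_vec_def)
  finally show ?thesis .
qed

lemma quad_form_le_trace: "quad_form P \<theta> \<le> (norm \<theta>)\<^sup>2 * trace (gram P)"
proof -
  have "quad_form P \<theta> \<le> (\<integral>x. (norm \<theta>)\<^sup>2 * (norm x)\<^sup>2 \<partial>P)"
    unfolding quad_form_def
    using inner_power2_le[of \<theta>] moment2 by (intro integral_mono moment_inner2) auto
  then show ?thesis using moment2 by (simp add: trace_gram)
qed

lemma trace_nonneg: "0 \<le> trace (gram P)"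
  by (simp add: trace_gram)

lemma trace_le_s4: "trace (gram P) \<le> s4"
proof -
  have "(trace (gram P))\<^sup>2 \<le> s4\<^sup>2"
    using integral_mult_square_le[of P "\<lambda>_. 1" "\<lambda>x. (norm x)\<^sup>2"] moment moment2
    by (simp add: trace_gram s4_sq prob_space flip: power_mult)
  then show ?thesis using s4_nonneg by (rule power2_le_imp_le)
qed

end

text \<open>
  The inequality is required for all directions, including those in which \<open>\<langle>\<theta>, X\<rangle>\<close> vanishes almost
  surely, where both sides are zero.
\<close>

locale kurtosis_bound = fourth_moment P for P :: "(real ^ 'd) measure" +
  fixes \<kappa> :: real
  assumes kappa_nonneg: "0 \<le> \<kappa>"
    and kurtosis: "\<And>\<theta>. (\<integral>x. (\<theta> \<bullet> x) ^ 4 \<partial>P) \<le> \<kappa> * (quad_form P \<theta>)\<^sup>2"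
begin

lemma mixed_moment_le: "(\<integral>x. (\<theta> \<bullet> x)\<^sup>2 * (norm x)\<^sup>2 \<partial>P) \<le> sqrt \<kappa> * quad_form P \<theta> * s4"
proof -
  have "(\<integral>x. (\<theta> \<bullet> x)\<^sup>2 * (norm x)\<^sup>2 \<partial>P)\<^sup>2 \<le> (\<integral>x. (\<theta> \<bullet> x) ^ 4 \<partial>P) * s4\<^sup>2"
    using integral_mult_square_le[of P "\<lambda>x. (\<theta> \<bullet> x)\<^sup>2" "\<lambda>x. (norm x)\<^sup>2"] moment moment_inner4 moment_mixed
    by (simp add: s4_sq flip: power_mult)
  also have "\<dots> \<le> (\<kappa> * (quad_form P \<theta>)\<^sup>2) * s4\<^sup>2" by (intro mult_right_mono kurtosis) auto
  also have "\<dots> = (sqrt \<kappa> * quad_form P \<theta> * s4)\<^sup>2" using kappa_nonneg by (simp add: power_mult_distrib)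
  finally show ?thesis
    by (rule power2_le_imp_le) (simp add: kappa_nonneg s4_nonneg quad_form_nonneg)
qed

text \<open>
  Expanding \<open>\<parallel>X\<parallel>\<^sup>4\<close> into products of squared coordinates, the Cauchy-Schwarz inequality and the
  kurtosis bound in the coordinate directions apply to each product.
\<close>

lemma s4_le_trace: "s4 \<le> sqrt \<kappa> * trace (gram P)"
proof -
  define N where "N = (\<lambda>i::'d. quad_form P (axis i 1))"
  have comp: "axis i 1 \<bullet> x = x $ i" for i and x :: "real ^ 'd"
    by (simp add: inner_axis inner_commute)
  have int: "integrable P (\<lambda>x. (x $ i)\<^sup>2 * (x $ j)\<^sup>2)" for i j
  proof (rule integrable_of_quartic_bound[where c=1])
    fix x :: "real ^ 'd"
    have "(x $ i)\<^sup>2 * (x $ j)\<^sup>2 \<le> (norm x)\<^sup>2 * (norm x)\<^sup>2"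
      using component_le_norm_cart[of x i] component_le_norm_cart[of x j]
      by (intro mult_mono) (auto simp: abs_le_square_iff[symmetric])
    then show "\<bar>(x $ i)\<^sup>2 * (x $ j)\<^sup>2\<bar> \<le> 1 * (1 + norm x ^ 4)" by (simp flip: power_add)
  qed measurable
  have each: "(\<integral>x. (x $ i)\<^sup>2 * (x $ j)\<^sup>2 \<partial>P) \<le> \<kappa> * (N i * N j)" for i j
  proof -
    have "(\<integral>x. (x $ i)\<^sup>2 * (x $ j)\<^sup>2 \<partial>P)\<^sup>2 \<le> (\<integral>x. (x $ i) ^ 4 \<partial>P) * (\<integral>x. (x $ j) ^ 4 \<partial>P)"
      using integral_mult_square_le[of P "\<lambda>x. (x $ i)\<^sup>2" "\<lambda>x. (x $ j)\<^sup>2"] int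
        moment_inner4[of "axis i 1"] moment_inner4[of "axis j 1"]
      by (simp add: comp flip: power_mult)
    also have "\<dots> \<le> (\<kappa> * (N i)\<^sup>2) * (\<kappa> * (N j)\<^sup>2)"
      using kurtosis[of "axis i 1"] kurtosis[of "axis j 1"] kappa_nonneg
      by (intro mult_mono) (auto simp: comp N_def)
    also have "\<dots> = (\<kappa> * (N i * N j))\<^sup>2" by (simp add: power2_eq_square)
    finally show ?thesis
      by (rule power2_le_imp_le) (simp add: kappa_nonneg quad_form_nonneg N_def)
  qed
  \<comment> \<open>The coordinate directions turn kurtosis and quadratic form into moments of coordinates.\<close>
  have norm2: "(norm x)\<^sup>2 = (\<Sum>i\<in>UNIV. (x $ i)\<^sup>2)" for x :: "real ^ 'd"
    unfolding power2_norm_eq_inner inner_vec_def by (simp add: power2_eq_square)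
  have int2: "integrable P (\<lambda>x. (x $ i)\<^sup>2)" for i
    using moment_inner2[of "axis i 1"] by (simp add: comp)
  have tr: "trace (gram P) = (\<Sum>i\<in>UNIV. N i)"
  proof -
    have "trace (gram P) = (\<integral>x. (\<Sum>i\<in>UNIV. (x $ i)\<^sup>2) \<partial>P)"
      by (simp only: trace_gram norm2)
    also have "\<dots> = (\<Sum>i\<in>UNIV. (\<integral>x. (x $ i)\<^sup>2 \<partial>P))"
      by (rule Bochner_Integration.integral_sum) (rule int2)
    finally show ?thesis by (simp add: N_def quad_form_def comp)
  qed
  have "s4\<^sup>2 = (\<integral>x. (\<Sum>i\<in>UNIV. \<Sum>j\<in>UNIV. (x $ i)\<^sup>2 * (x $ j)\<^sup>2) \<partial>P)"
  proof -
    have "norm x ^ 4 = (\<Sum>i\<in>UNIV. \<Sum>j\<in>UNIV. (x $ i)\<^sup>2 * (x $ j)\<^sup>2)" for x :: "real ^ 'd"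
    proof -
      have "norm x ^ 4 = (norm x)\<^sup>2 * (norm x)\<^sup>2" by (simp flip: power_add)
      then show ?thesis by (simp only: norm2 sum_product)
    qed
    then show ?thesis by (simp add: s4_sq)
  qed
  also have "\<dots> = (\<Sum>i\<in>UNIV. \<Sum>j\<in>UNIV. (\<integral>x. (x $ i)\<^sup>2 * (x $ j)\<^sup>2 \<partial>P))"
    using int by (simp add: Bochner_Integration.integral_sum Bochner_Integration.integrable_sum)
  also have "\<dots> \<le> (\<Sum>i\<in>UNIV. \<Sum>j\<in>UNIV. \<kappa> * (N i * N j))" by (intro sum_mono each)
  also have "\<dots> = \<kappa> * (trace (gram P))\<^sup>2"
    unfolding tr power2_eq_square sum_product by (simp only: sum_distrib_left)
  also have "\<dots> = (sqrt \<kappa> * trace (gram P))\<^sup>2" using kappa_nonneg by (simp add: power_mult_distrib)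
  finally show ?thesis
    by (rule power2_le_imp_le) (simp add: kappa_nonneg trace_nonneg)
qed

text \<open>
  The PAC-Bayesian inequality for \<open>log_weight\<close>. Averaging its logarithmic moment over the Gaussian
  perturbation and exchanging this average with the expectation over \<open>X\<close> leaves an explicit
  polynomial in \<open>\<langle>\<theta>, x\<rangle>\<^sup>2\<close> and \<open>\<parallel>x\<parallel>\<^sup>2\<close>; the kurtosis bound does the rest. The constants are
  \<open>45 = 2 + 43\<close> and \<open>65.5 = 1 + 3/2 * 43\<close>, the first summands coming from half the variance
  of the perturbation.
\<close>

lemma uniform_soft_clip_bound:
  assumes M: "prob_space M" and I: "finite I"
    and indep: "prob_space.indep_vars M (\<lambda>_. borel) X I"
    and law: "\<And>i. i \<in> I \<Longrightarrow> distr M borel (X i) = P"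
    and v: "0 < v" and e: "0 < e" and \<delta>: "\<delta>\<^sup>2 = 1"
  shows "\<exists>A \<in> sets M. measure M A \<ge> 1 - e \<and> (\<forall>\<omega> \<in> A. \<forall>\<theta>.
    (\<Sum>i\<in>I. soft_clip (\<delta> * ((\<theta> \<bullet> X i \<omega>)\<^sup>2 - l)))
      \<le> real (card I) * (\<delta> * (quad_form P \<theta> - l)
          + (\<kappa> * (quad_form P \<theta>)\<^sup>2 - 2 * l * quad_form P \<theta> + l\<^sup>2) / 2
          + 45 * v\<^sup>2 * (sqrt \<kappa> * quad_form P \<theta> * s4) + 65.5 * (v\<^sup>2 * s4)\<^sup>2)
        + (norm \<theta>)\<^sup>2 / (2 * v\<^sup>2) + ln (1 / e))"
proof -
  interpret G: prob_space "gauss_vec v :: (real ^ 'd) measure" by (rule prob_space_gauss_vec[OF v])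
  interpret PG: pair_sigma_finite P "gauss_vec v :: (real ^ 'd) measure" by unfold_locales
  define J where "J = (\<lambda>\<theta>. \<integral>x. weight_excess \<delta> l v \<theta> x \<partial>P)"
  have we_nonneg: "0 \<le> 1 + weight_excess \<delta> l v \<theta> x" for \<theta> x :: "real ^ 'd"
    using exp_log_weight_le[of \<delta> l v \<theta> x] exp_ge_zero order_trans by blast
  have we_m [measurable]: "(\<lambda>(\<theta>, x). weight_excess \<delta> l v \<theta> x) \<in> borel_measurable (borel \<Otimes>\<^sub>M (borel :: (real ^ 'd) measure))"
    unfolding weight_excess_def pert_dev_def jensen_cost_def case_prod_beta by measurable
  have we_int: "integrable P (\<lambda>x. weight_excess \<delta> l v \<theta> x)" for \<theta>
  proof -
    have "weight_excess \<delta> l v \<theta> x = (- \<delta> * l + l\<^sup>2 / 2) + (\<delta> - l) * (\<theta> \<bullet> x)\<^sup>2 + (1/2) * (\<theta> \<bullet> x) ^ 4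
        + (l * v\<^sup>2 - \<delta> * v\<^sup>2) * (norm x)\<^sup>2 + 42 * v\<^sup>2 * ((\<theta> \<bullet> x)\<^sup>2 * (norm x)\<^sup>2) + 22 * v ^ 4 * norm x ^ 4" for x
    proof -
      define m where "m = (\<theta> \<bullet> x)\<^sup>2"
      define q where "q = v\<^sup>2 * (norm x)\<^sup>2"
      have "weight_excess \<delta> l v \<theta> x = \<delta> * (m - l - q) + \<delta>\<^sup>2 * (m - l - q)\<^sup>2 / 2 + 43 * (m * q + q\<^sup>2 / 2)"
        by (simp add: weight_excess_def pert_dev_def jensen_cost_def m_def q_def power_mult_distrib)
      also have "\<dots> = (- \<delta> * l + l\<^sup>2 / 2) + (\<delta> - l) * m + (1/2) * m\<^sup>2 + (l - \<delta>) * q + 42 * (m * q) + 22 * q\<^sup>2"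
        unfolding \<delta> by (simp add: power2_eq_square field_simps)
      finally show ?thesis unfolding m_def q_def by (simp add: algebra_simps flip: power_mult)
    qed
    moreover have "integrable P (\<lambda>x. (- \<delta> * l + l\<^sup>2 / 2) + (\<delta> - l) * (\<theta> \<bullet> x)\<^sup>2 + (1/2) * (\<theta> \<bullet> x) ^ 4
        + (l * v\<^sup>2 - \<delta> * v\<^sup>2) * (norm x)\<^sup>2 + 42 * v\<^sup>2 * ((\<theta> \<bullet> x)\<^sup>2 * (norm x)\<^sup>2) + 22 * v ^ 4 * norm x ^ 4)"
      using moment moment2 moment_inner2 moment_inner4 moment_mixed
      by (intro Bochner_Integration.integrable_add integrable_mult_right integrable_const) auto
    ultimately show ?thesis by simp
  qed
  define mean where "mean = (\<lambda>(\<theta> :: real ^ 'd) (x :: real ^ 'd). \<delta> * ((\<theta> \<bullet> x)\<^sup>2 - l) + ((\<theta> \<bullet> x)\<^sup>2 - l)\<^sup>2 / 2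
      + 45 * ((\<theta> \<bullet> x)\<^sup>2 * (v\<^sup>2 * (norm x)\<^sup>2)) + 65.5 * (v\<^sup>2 * (norm x)\<^sup>2)\<^sup>2)"
  have mean_eq: "mean \<theta> = (\<lambda>x. (- \<delta> * l + l\<^sup>2 / 2) + (\<delta> - l) * (\<theta> \<bullet> x)\<^sup>2 + (1/2) * (\<theta> \<bullet> x) ^ 4
        + 45 * v\<^sup>2 * ((\<theta> \<bullet> x)\<^sup>2 * (norm x)\<^sup>2) + 65.5 * v ^ 4 * norm x ^ 4)" for \<theta>
    unfolding mean_def by (rule ext) (simp add: field_simps eval_nat_numeral)
  have mean_int: "integrable P (mean \<theta>)" for \<theta>
    unfolding mean_eq using moment moment2 moment_inner2 moment_inner4 moment_mixed
    by (intro Bochner_Integration.integrable_add integrable_mult_right integrable_const) auto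
  have pair: "integrable (P \<Otimes>\<^sub>M gauss_vec v) (\<lambda>(x, \<eta>). 1 + weight_excess \<delta> l v (\<theta> + \<eta>) x)" for \<theta>
  proof (rule PG.Fubini_integrable)
    show "(\<lambda>(x, \<eta>). 1 + weight_excess \<delta> l v (\<theta> + \<eta>) x) \<in> borel_measurable (P \<Otimes>\<^sub>M gauss_vec v)"
      unfolding weight_excess_def pert_dev_def jensen_cost_def case_prod_beta by measurable
    \<comment> \<open>Adding 1 makes the integrand nonnegative, so its absolute value has an explicit mean.\<close>
    have "(\<integral>\<eta>. norm (1 + weight_excess \<delta> l v (\<theta> + \<eta>) x) \<partial>gauss_vec v) = 1 + mean \<theta> x" for x
      using weight_excess_gauss_mean[OF v \<delta>, of l \<theta> x] we_nonneg
      by (simp add: measure_gauss_vec_UNIV[OF v] mean_def)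
    then show "integrable P (\<lambda>x. \<integral>\<eta>. norm (case (x, \<eta>) of (x, \<eta>) \<Rightarrow> 1 + weight_excess \<delta> l v (\<theta> + \<eta>) x) \<partial>gauss_vec v)"
      using mean_int[of \<theta>] by simp
    show "AE x in P. integrable (gauss_vec v) (\<lambda>\<eta>. case (x, \<eta>) of (x, \<eta>) \<Rightarrow> 1 + weight_excess \<delta> l v (\<theta> + \<eta>) x)"
      by (intro AE_I2) (simp add: weight_excess_gauss_mean(1)[OF v \<delta>])
  qed
  have J_int: "integrable (gauss_vec v) (\<lambda>\<eta>. J (\<theta> + \<eta>))"
    and J_mean: "(\<integral>\<eta>. J (\<theta> + \<eta>) \<partial>gauss_vec v) = (\<integral>x. mean \<theta> x \<partial>P)" for \<theta>
  proof -
    have J1: "(\<integral>x. 1 + weight_excess \<delta> l v (\<theta> + \<eta>) x \<partial>P) = 1 + J (\<theta> + \<eta>)" for \<eta>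
      using we_int by (simp add: J_def prob_space)
    have "integrable (gauss_vec v) (\<lambda>\<eta>. 1 + J (\<theta> + \<eta>))"
      using PG.integrable_snd[OF pair[of \<theta>]] by (simp add: J1)
    then have "integrable (gauss_vec v) (\<lambda>\<eta>. (1 + J (\<theta> + \<eta>)) - 1)" by (intro Bochner_Integration.integrable_diff) auto
    then show i: "integrable (gauss_vec v) (\<lambda>\<eta>. J (\<theta> + \<eta>))" by simp
    have "(\<integral>\<eta>. 1 + J (\<theta> + \<eta>) \<partial>gauss_vec v) = (\<integral>x. (\<integral>\<eta>. 1 + weight_excess \<delta> l v (\<theta> + \<eta>) x \<partial>gauss_vec v) \<partial>P)"
      using PG.Fubini_integral[OF pair[of \<theta>]] by (simp add: J1)
    also have "\<dots> = (\<integral>x. 1 + mean \<theta> x \<partial>P)"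
      using weight_excess_gauss_mean[OF v \<delta>, where l=l and \<theta>=\<theta>]
      by (simp add: measure_gauss_vec_UNIV[OF v] mean_def)
    finally show "(\<integral>\<eta>. J (\<theta> + \<eta>) \<partial>gauss_vec v) = (\<integral>x. mean \<theta> x \<partial>P)"
      using i mean_int[of \<theta>] by (simp add: measure_gauss_vec_UNIV[OF v] prob_space)
  qed
  have mean_le: "(\<integral>x. mean \<theta> x \<partial>P) \<le> \<delta> * (quad_form P \<theta> - l)
          + (\<kappa> * (quad_form P \<theta>)\<^sup>2 - 2 * l * quad_form P \<theta> + l\<^sup>2) / 2
          + 45 * v\<^sup>2 * (sqrt \<kappa> * quad_form P \<theta> * s4) + 65.5 * (v\<^sup>2 * s4)\<^sup>2" for \<theta>
  proof -
    have "(\<integral>x. mean \<theta> x \<partial>P) = (- \<delta> * l + l\<^sup>2 / 2) + (\<delta> - l) * quad_form P \<theta> + (1/2) * (\<integral>x. (\<theta> \<bullet> x) ^ 4 \<partial>P)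
        + 45 * v\<^sup>2 * (\<integral>x. (\<theta> \<bullet> x)\<^sup>2 * (norm x)\<^sup>2 \<partial>P) + 65.5 * v ^ 4 * s4\<^sup>2"
      unfolding mean_eq using moment moment2 moment_inner2 moment_inner4 moment_mixed
      by (simp add: quad_form_def s4_sq prob_space)
    also have "\<dots> \<le> (- \<delta> * l + l\<^sup>2 / 2) + (\<delta> - l) * quad_form P \<theta> + (1/2) * (\<kappa> * (quad_form P \<theta>)\<^sup>2)
        + 45 * v\<^sup>2 * (sqrt \<kappa> * quad_form P \<theta> * s4) + 65.5 * v ^ 4 * s4\<^sup>2"
      by (intro add_mono mult_left_mono kurtosis mixed_moment_le order_refl) auto
    also have "\<dots> = \<delta> * (quad_form P \<theta> - l)
          + (\<kappa> * (quad_form P \<theta>)\<^sup>2 - 2 * l * quad_form P \<theta> + l\<^sup>2) / 2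
          + 45 * v\<^sup>2 * (sqrt \<kappa> * quad_form P \<theta> * s4) + 65.5 * (v\<^sup>2 * s4)\<^sup>2"
      by (simp add: power_mult_distrib field_simps flip: power_mult)
    finally show ?thesis .
  qed
  have "\<exists>A \<in> sets M. measure M A \<ge> 1 - e \<and> (\<forall>\<omega> \<in> A. \<forall>\<theta>.
    (\<Sum>i\<in>I. \<integral>\<eta>. log_weight \<delta> l v (\<theta> + \<eta>) (X i \<omega>) \<partial>gauss_vec v)
      \<le> real (card I) * (\<integral>\<eta>. J (\<theta> + \<eta>) \<partial>gauss_vec v) + (norm \<theta>)\<^sup>2 / (2 * v\<^sup>2) + ln (1 / e))"
  proof (rule pac_bayes_gauss[OF M I indep law _ v e])
    show "(\<lambda>(\<theta>, x). log_weight \<delta> l v \<theta> x) \<in> borel_measurable (borel \<Otimes>\<^sub>M borel)"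
      unfolding log_weight_def pert_dev_def jensen_cost_def case_prod_beta by measurable
    show "J \<in> borel_measurable borel"
      unfolding J_def by measurable
    fix \<theta> :: "real ^ 'd"
    have "(\<integral>\<^sup>+x. ennreal (exp (log_weight \<delta> l v \<theta> x)) \<partial>P) \<le> (\<integral>\<^sup>+x. ennreal (1 + weight_excess \<delta> l v \<theta> x) \<partial>P)"
      by (intro nn_integral_mono ennreal_leI exp_log_weight_le)
    also have "\<dots> = ennreal (1 + J \<theta>)"
      using we_int[of \<theta>] we_nonneg by (subst nn_integral_eq_integral) (auto simp: J_def prob_space)
    also have "\<dots> \<le> ennreal (exp (J \<theta>))" by (intro ennreal_leI exp_ge_add_one_self)
    finally show "(\<integral>\<^sup>+x. ennreal (exp (log_weight \<delta> l v \<theta> x)) \<partial>P) \<le> ennreal (exp (J \<theta>))" .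
    show "integrable (gauss_vec v) (\<lambda>\<eta>. log_weight \<delta> l v (\<theta> + \<eta>) x)" for x
      by (rule log_weight_gauss_mean_ge[OF v \<delta>])
    show "integrable (gauss_vec v) (\<lambda>\<eta>. J (\<theta> + \<eta>))" by (rule J_int)
  qed auto
  then obtain A where A: "A \<in> sets M" "measure M A \<ge> 1 - e"
    and *: "\<And>\<omega> \<theta>. \<omega> \<in> A \<Longrightarrow> (\<Sum>i\<in>I. \<integral>\<eta>. log_weight \<delta> l v (\<theta> + \<eta>) (X i \<omega>) \<partial>gauss_vec v)
      \<le> real (card I) * (\<integral>\<eta>. J (\<theta> + \<eta>) \<partial>gauss_vec v) + (norm \<theta>)\<^sup>2 / (2 * v\<^sup>2) + ln (1 / e)"
    by blast
  show ?thesis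
  proof (intro bexI[OF _ A(1)] conjI A(2) ballI allI)
    fix \<omega> \<theta> assume \<omega>: "\<omega> \<in> A"
    have "(\<Sum>i\<in>I. soft_clip (\<delta> * ((\<theta> \<bullet> X i \<omega>)\<^sup>2 - l)))
      \<le> (\<Sum>i\<in>I. \<integral>\<eta>. log_weight \<delta> l v (\<theta> + \<eta>) (X i \<omega>) \<partial>gauss_vec v)"
      by (intro sum_mono log_weight_gauss_mean_ge[OF v \<delta>])
    also note *[OF \<omega>, of \<theta>]
    also have "real (card I) * (\<integral>\<eta>. J (\<theta> + \<eta>) \<partial>gauss_vec v) \<le> real (card I) * (\<delta> * (quad_form P \<theta> - l)
          + (\<kappa> * (quad_form P \<theta>)\<^sup>2 - 2 * l * quad_form P \<theta> + l\<^sup>2) / 2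
          + 45 * v\<^sup>2 * (sqrt \<kappa> * quad_form P \<theta> * s4) + 65.5 * (v\<^sup>2 * s4)\<^sup>2)"
      unfolding J_mean by (intro mult_left_mono mean_le) auto
    finally show "(\<Sum>i\<in>I. soft_clip (\<delta> * ((\<theta> \<bullet> X i \<omega>)\<^sup>2 - l)))
      \<le> real (card I) * (\<delta> * (quad_form P \<theta> - l)
          + (\<kappa> * (quad_form P \<theta>)\<^sup>2 - 2 * l * quad_form P \<theta> + l\<^sup>2) / 2
          + 45 * v\<^sup>2 * (sqrt \<kappa> * quad_form P \<theta> * s4) + 65.5 * (v\<^sup>2 * s4)\<^sup>2)
        + (norm \<theta>)\<^sup>2 / (2 * v\<^sup>2) + ln (1 / e)" by simp
  qed
qed

end

section \<open>From clipped sums to relative deviations\<close>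

text \<open>
  For \<open>u = 1\<close> this is the variance bound. For \<open>u < 1\<close> half the second moment may be larger by
  \<open>l\<^sup>2 (1 - u)\<^sup>2 / 2\<close>, but the mean \<open>l (u - 1)\<close> is then negative and outweighs this as long as \<open>l \<le> 2\<close>.
\<close>

lemma centred_second_moment_le:
  fixes u l a :: real
  assumes "0 \<le> u" "u \<le> 1" "0 < l" "l \<le> 2" "0 \<le> a"
  shows "(l * u - l) + ((1 + a) * (l * u)\<^sup>2 - 2 * l * (l * u) + l\<^sup>2) / 2 \<le> l * (l * a / 2)"
proof -
  have "u\<^sup>2 \<le> 1" using assms by (simp add: power_le_one)
  then have "(l / 2) * (a * u\<^sup>2) \<le> (l / 2) * (a * 1)" using assms by (intro mult_left_mono) auto
  moreover have "(l / 2) * ((1 - u) * (1 - u)) \<le> 1 * (1 * (1 - u))"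
    using assms by (intro mult_mono) auto
  ultimately have "(u - 1) + (l / 2) * (a * u\<^sup>2) + (l / 2) * ((1 - u) * (1 - u)) \<le> l * a / 2"
    by simp
  then have "l * ((u - 1) + (l / 2) * (a * u\<^sup>2) + (l / 2) * ((1 - u) * (1 - u))) \<le> l * (l * a / 2)"
    using assms by (intro mult_left_mono) auto
  moreover have "l * ((u - 1) + (l / 2) * (a * u\<^sup>2) + (l / 2) * ((1 - u) * (1 - u)))
    = (l * u - l) + ((1 + a) * (l * u)\<^sup>2 - 2 * l * (l * u) + l\<^sup>2) / 2"
    by (simp add: power2_eq_square field_simps)
  ultimately show ?thesis by simp
qed

text \<open>
  The clipped inequality is applied at the scale \<open>s = l / t\<close>. The truncation error
  \<open>(s Y\<^sub>i)\<^sup>3 / 3\<close> is at most \<open>s Y\<^sub>i\<close> times \<open>(l R2 / t)\<^sup>2 / 3\<close>, a multiple of the sum itself. The error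
  terms \<open>E1\<close>, \<open>pen\<close> and \<open>E2\<close> stand for the parts of the bound that come from the perturbation,
  from the Kullback divergence and from the confidence level.
\<close>

lemma relative_upper_deviation:
  fixes Y :: "'i \<Rightarrow> real" and a E1 E2 pen l t N D R2 :: real
  assumes I: "finite I" "I \<noteq> {}" and Y: "\<And>i. i \<in> I \<Longrightarrow> 0 \<le> Y i \<and> Y i \<le> R2"
    and N: "0 \<le> N" "N \<le> t" and t: "0 < t" and l: "0 < l" "l \<le> 2" and a: "0 \<le> a" and E1: "0 \<le> E1"
    and D: "l * a / 2 + E1 + pen / t + E2 / l \<le> D"
    and dev: "\<And>s. 0 \<le> s \<Longrightarrow> (\<Sum>i\<in>I. soft_clip (s * Y i - l)) \<le> real (card I) *
      ((s * N - l) + ((1 + a) * (s * N)\<^sup>2 - 2 * l * (s * N) + l\<^sup>2) / 2 + s * N * E1 + s * pen + E2)"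
  shows "(1 - (l * R2 / t)\<^sup>2 / 3) * ((\<Sum>i\<in>I. Y i) / card I / t) \<le> 1 + D"
proof -
  define n where "n = real (card I)"
  have n: "0 < n" using I by (simp add: n_def card_gt_0_iff)
  define s where "s = l / t"
  define u where "u = N / t"
  have s: "0 < s" using l t by (simp add: s_def)
  have u: "0 \<le> u" "u \<le> 1" using N t by (auto simp: u_def)
  have sN: "s * N = l * u" by (simp add: s_def u_def)
  define S where "S = (\<Sum>i\<in>I. Y i)"
  define \<tau> where "\<tau> = (s * R2)\<^sup>2 / 3"
  have lower: "(1 - \<tau>) * (s * Y i) - l \<le> soft_clip (s * Y i - l)" if i: "i \<in> I" for i
  proof -
    have y: "0 \<le> s * Y i" "s * Y i \<le> s * R2" using Y[OF i] s by auto
    have "(s * Y i) ^ 3 / 3 = (s * Y i)\<^sup>2 * (s * Y i) / 3" by (simp add: power2_eq_square power3_eq_cube)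
    also have "\<dots> \<le> (s * R2)\<^sup>2 * (s * Y i) / 3"
      using y by (intro divide_right_mono mult_right_mono power_mono) auto
    finally have "(s * Y i) ^ 3 / 3 \<le> \<tau> * (s * Y i)" by (simp add: \<tau>_def)
    moreover have "(s * Y i - l) - (s * Y i) ^ 3 / 3 \<le> soft_clip (s * Y i - l)"
      using y l by (intro soft_clip_ge_cubic) auto
    ultimately show ?thesis by (simp add: algebra_simps)
  qed
  have "(1 - \<tau>) * (s * S) - n * l = (\<Sum>i\<in>I. (1 - \<tau>) * (s * Y i) - l)"
    by (simp add: S_def n_def sum_subtractf sum_distrib_left)
  also have "\<dots> \<le> (\<Sum>i\<in>I. soft_clip (s * Y i - l))" by (intro sum_mono lower)
  also have "\<dots> \<le> n * ((s * N - l) + ((1 + a) * (s * N)\<^sup>2 - 2 * l * (s * N) + l\<^sup>2) / 2 + s * N * E1 + s * pen + E2)"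
    unfolding n_def using s by (intro dev) auto
  also have "\<dots> \<le> n * (l * D)"
  proof (intro mult_left_mono)
    have "l * u * E1 \<le> l * 1 * E1" using u l E1 by (intro mult_mono) auto
    moreover have "l * (l * a / 2 + E1 + pen / t + E2 / l) = l * (l * a / 2) + l * E1 + s * pen + E2"
      using l by (simp add: s_def distrib_left)
    moreover have "l * (l * a / 2 + E1 + pen / t + E2 / l) \<le> l * D" using D l by (intro mult_left_mono) auto
    ultimately show "(s * N - l) + ((1 + a) * (s * N)\<^sup>2 - 2 * l * (s * N) + l\<^sup>2) / 2 + s * N * E1 + s * pen + E2 \<le> l * D"
      using centred_second_moment_le[OF u l a] unfolding sN by linarith
  qed (use n in simp)
  finally have "(1 - \<tau>) * (s * S) \<le> n * l * (1 + D)" by (simp add: algebra_simps)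
  then have "(1 - \<tau>) * (s * S) / (n * l) \<le> 1 + D" using n l by (simp add: pos_divide_le_eq mult.commute)
  moreover have "(1 - \<tau>) * (s * S) / (n * l) = (1 - (l * R2 / t)\<^sup>2 / 3) * (S / n / t)"
  proof -
    have "s * S / (n * l) = S / n / t" using l by (simp add: s_def)
    moreover have "\<tau> = (l * R2 / t)\<^sup>2 / 3" by (simp add: \<tau>_def s_def)
    ultimately show ?thesis by (metis times_divide_eq_right)
  qed
  ultimately show ?thesis by (simp add: S_def n_def)
qed

text \<open>
  The inequality at the scale \<open>l v / N\<close> contains the gain \<open>1 - v\<close>, while the errors grow from \<open>D\<close> to
  roughly \<open>v D\<close>. The excess over \<open>v D\<close> is of order \<open>D\<^sup>2\<close> and is absorbed by the difference between
  \<open>B = D / (1 - 4 D)\<close> and \<open>D\<close>, since \<open>v - 1 = v B\<close>.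
\<close>

lemma lower_scale_gain:
  fixes l a E1 p E2 D B v :: real
  assumes D: "l * a / 2 + E1 + p + E2 / l \<le> D" "0 \<le> D" "6 * D \<le> 1"
    and l: "0 < l" "l \<le> 1.14 * (1 - 6 * D)" "l * a / 2 \<le> 0.57 * D" and a: "0 \<le> a" and E2: "0 \<le> E2"
    and B: "B = D / (1 - 4 * D)" and v: "v = 1 / (1 - B)"
  shows "(1 - v) + ((1 + a) * (l * v)\<^sup>2 - 2 * l * (l * v) + l\<^sup>2) / (2 * l) + v * E1 + v * p + E2 / l \<le> 0"
proof -
  have pos: "0 < 1 - 4 * D" "0 < 1 - 5 * D" using D by auto
  have v': "v = (1 - 4 * D) / (1 - 5 * D)" using pos by (simp add: v B field_simps)
  have v1: "v - 1 = D / (1 - 5 * D)" using pos by (simp add: v' field_simps)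
  have vge: "1 \<le> v" using v1 D pos by (smt (verit) divide_nonneg_pos)
  \<comment> \<open>Unlike the other error terms, this one does not grow with v; it is enlarged to match them.\<close>
  have e2: "1 * (E2 / l) \<le> v * (E2 / l)" using vge E2 l by (intro mult_right_mono) auto
  have vD: "v * (l * a / 2 + E1 + p + E2 / l) \<le> v * D" using D vge by (intro mult_left_mono) auto
  have quad: "((1 + a) * (l * v)\<^sup>2 - 2 * l * (l * v) + l\<^sup>2) / (2 * l)
      = v * (l * a / 2) + v * (v - 1) * (l * a / 2) + (l / 2) * (v - 1)\<^sup>2"
    using l by (simp add: power2_eq_square field_simps)
  have key: "v * (v - 1) * (l * a / 2) + (l / 2) * (v - 1)\<^sup>2 \<le> (v - 1) - v * D"
  proof -
    have "v * (v - 1) * (l * a / 2) + (l / 2) * (v - 1)\<^sup>2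
      \<le> v * (v - 1) * (0.57 * D) + (0.57 * (1 - 6 * D)) * (v - 1)\<^sup>2"
      using l vge by (intro add_mono mult_left_mono mult_right_mono) auto
    also have "\<dots> = D\<^sup>2 / (1 - 5 * D)\<^sup>2 * (0.57 * (1 - 4 * D) + 0.57 * (1 - 6 * D))"
      unfolding v1 v' using pos by (simp add: power2_eq_square divide_simps) (simp add: algebra_simps)
    also have "\<dots> \<le> D\<^sup>2 / (1 - 5 * D)\<^sup>2 * (4 * (1 - 5 * D))"
    proof (rule mult_left_mono)
      show "0.57 * (1 - 4 * D) + 0.57 * (1 - 6 * D) \<le> 4 * (1 - 5 * D)"
        using D(3) by (simp add: field_simps)
    qed simp
    also have "\<dots> = (v - 1) - v * D"
      unfolding v1 v' using pos by (simp add: power2_eq_square divide_simps) (simp add: algebra_simps)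
    finally show ?thesis .
  qed
  show ?thesis using e2 vD key unfolding quad distrib_left by linarith
qed

text \<open>
  At the scale \<open>s = l v / N\<close> with \<open>v = 1 / (1 - B)\<close> the sum of the clipped variables is not positive.
  If all \<open>Y\<^sub>i\<close> were below \<open>N / v\<close>, every summand would be positive; hence \<open>N / v \<le> R2\<close>, and
  the truncation error \<open>l\<^sup>2 / 3\<close> is bounded by \<open>v\<^sup>2\<close> times \<open>(l R2 / N)\<^sup>2 / 3\<close>.
\<close>

lemma relative_lower_deviation:
  fixes Y :: "'i \<Rightarrow> real" and a E1 E2 pen l N D R2 :: real
  assumes I: "finite I" "I \<noteq> {}" and Y: "\<And>i. i \<in> I \<Longrightarrow> 0 \<le> Y i \<and> Y i \<le> R2"
    and N: "0 < N" and a: "0 \<le> a" and E2: "0 \<le> E2"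
    and D: "l * a / 2 + E1 + pen / N + E2 / l \<le> D" "0 \<le> D" "6 * D < 1"
    and l: "0 < l" "l \<le> 1.14 * (1 - 6 * D)" "l * a / 2 \<le> 0.57 * D"
    and dev: "\<And>s. 0 \<le> s \<Longrightarrow> (\<Sum>i\<in>I. soft_clip (l - s * Y i)) \<le> real (card I) *
      ((l - s * N) + ((1 + a) * (s * N)\<^sup>2 - 2 * l * (s * N) + l\<^sup>2) / 2 + s * N * E1 + s * pen + E2)"
    and B: "B = D / (1 - 4 * D)"
  shows "(1 - B) - (l * R2 / N)\<^sup>2 / 3 / (1 - B) \<le> (\<Sum>i\<in>I. Y i) / card I / N"
proof -
  define n where "n = real (card I)"
  have n: "0 < n" using I by (simp add: n_def card_gt_0_iff)
  define v where "v = 1 / (1 - B)"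
  have B1: "0 \<le> B" "B < 1" using D by (auto simp: B divide_simps)
  have v: "1 \<le> v" using B1 by (simp add: v_def)
  define s where "s = l * v / N"
  have s: "0 < s" "s * N = l * v" using l v N by (auto simp: s_def)
  have "(l - s * N) + ((1 + a) * (s * N)\<^sup>2 - 2 * l * (s * N) + l\<^sup>2) / 2 + s * N * E1 + s * pen + E2
    = l * ((1 - v) + ((1 + a) * (l * v)\<^sup>2 - 2 * l * (l * v) + l\<^sup>2) / (2 * l) + v * E1 + v * (pen / N) + E2 / l)"
    unfolding s(2) using l N by (simp add: s_def field_simps)
  also have "\<dots> \<le> l * 0"
    using l D by (intro mult_left_mono lower_scale_gain[OF D(1,2) _ l a E2 B v_def]) auto
  finally have rhs: "(l - s * N) + ((1 + a) * (s * N)\<^sup>2 - 2 * l * (s * N) + l\<^sup>2) / 2 + s * N * E1 + s * pen + E2 \<le> 0"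
    by simp
  have le0: "(\<Sum>i\<in>I. soft_clip (l - s * Y i)) \<le> 0"
    using dev[of s] s mult_nonneg_nonpos[OF _ rhs, of "real (card I)"] by simp
  have R2: "N / v \<le> R2"
  proof (rule ccontr)
    assume small: "\<not> N / v \<le> R2"
    have "0 < soft_clip (l - s * Y i)" if i: "i \<in> I" for i
    proof (rule soft_clip_pos)
      have "s * Y i < s * (N / v)" using Y[OF i] small s by (intro mult_strict_left_mono) auto
      also have "s * (N / v) = l" using N v by (simp add: s_def)
      finally show "0 < l - s * Y i" by simp
    qed
    then have "0 < (\<Sum>i\<in>I. soft_clip (l - s * Y i))" using I by (intro sum_pos) auto
    then show False using le0 by simp
  qed
  have l_le: "l \<le> v * (l * R2 / N)"
  proof -
    have "l * (N / v) \<le> l * R2" using R2 l by (intro mult_left_mono) auto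
    then show ?thesis using N v by (simp add: field_simps)
  qed
  have "(\<Sum>i\<in>I. l - s * Y i - l ^ 3 / 3) \<le> (\<Sum>i\<in>I. soft_clip (l - s * Y i))"
    using Y s l by (intro sum_mono soft_clip_ge_cubic) auto
  moreover have "(\<Sum>i\<in>I. l - s * Y i - l ^ 3 / 3) = n * (l - l ^ 3 / 3) - s * (\<Sum>i\<in>I. Y i)"
    by (simp add: sum_subtractf n_def sum_distrib_left right_diff_distrib)
  ultimately have "n * (l - l ^ 3 / 3) - s * (\<Sum>i\<in>I. Y i) \<le> 0"
    using le0 by simp
  then have "n * l * (1 - l\<^sup>2 / 3) \<le> n * l * (v * ((\<Sum>i\<in>I. Y i) / n / N))"
    using n by (simp add: s_def power3_eq_cube power2_eq_square algebra_simps)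
  moreover have "0 < n * l" using n l by simp
  ultimately have 1: "1 - l\<^sup>2 / 3 \<le> v * ((\<Sum>i\<in>I. Y i) / n / N)"
    using mult_le_cancel_left_pos by blast
  have "l\<^sup>2 \<le> (v * (l * R2 / N))\<^sup>2" using l_le l by (intro power_mono) auto
  also have "\<dots> = v\<^sup>2 * (l * R2 / N)\<^sup>2" by (rule power_mult_distrib)
  finally have "1 - v\<^sup>2 * ((l * R2 / N)\<^sup>2 / 3) \<le> v * ((\<Sum>i\<in>I. Y i) / n / N)"
    using 1 by linarith
  then have "(1 - v\<^sup>2 * ((l * R2 / N)\<^sup>2 / 3)) / v \<le> (\<Sum>i\<in>I. Y i) / n / N"
    using v by (simp add: pos_divide_le_eq mult.commute)
  moreover have "(1 - v\<^sup>2 * ((l * R2 / N)\<^sup>2 / 3)) / v = (1 - B) - (l * R2 / N)\<^sup>2 / 3 / (1 - B)"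
  proof -
    have "(1 - v\<^sup>2 * x) / v = 1 / v - v * x" for x using v by (simp add: power2_eq_square field_simps)
    from this[of "(l * R2 / N)\<^sup>2 / 3"] show ?thesis by (simp add: v_def)
  qed
  ultimately show ?thesis by (simp add: n_def)
qed

section \<open>Choice of the scale parameters\<close>

lemma c_const_bounds: "43 \<le> c_const" "c_const \<le> 47"
proof -
  have s: "1.41421 \<le> sqrt 2" "sqrt 2 \<le> 1.41422"
    by (rule real_le_rsqrt real_le_lsqrt; simp add: power2_eq_square)+
  have l: "2/3 \<le> ln (2::real)" "ln (2::real) \<le> 25/36"
    using ln2_ge_two_thirds ln2_le_25_over_36 by auto
  define x where "x = (1 + 2 * sqrt 2) / 2"
  have x: "1.9142 \<le> x" "x \<le> 1.91422" using s by (auto simp: x_def)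
  have e1: "6.6 \<le> exp x"
  proof -
    \<comment> \<open>The quadratic Taylor polynomial is accurate enough after dividing the exponent by 8.\<close>
    have "(1.2678::real) \<le> 1 + x/8 + (x/8)\<^sup>2/2"
    proof -
      have "(1.9142/8)\<^sup>2 \<le> (x/8)\<^sup>2" using x by (intro power_mono) auto
      then show ?thesis using x by (simp add: power2_eq_square)
    qed
    also have "\<dots> \<le> exp (x/8)" using x by (intro exp_lower_Taylor_quadratic) auto
    finally have "1.2678 ^ 8 \<le> exp (x/8) ^ 8" by (intro power_mono) auto
    also have "exp (x/8) ^ 8 = exp x" by (simp flip: exp_of_nat_mult)
    finally show ?thesis by (simp add: eval_nat_numeral)
  qed
  have e2: "exp x \<le> 6.82"
  proof -
    have "exp x * exp (2 - x) = exp 1 * exp 1" by (simp flip: exp_add)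
    also have "\<dots> \<le> 2.72 * 2.72" using e_less_272 by (intro mult_mono) auto
    finally have "exp x * exp (2 - x) \<le> 2.72 * 2.72" .
    moreover have "1.0857 \<le> exp (2 - x)" using exp_ge_add_one_self[of "2 - x"] x by simp
    ultimately have "exp x * 1.0857 \<le> 2.72 * 2.72"
      by (meson exp_ge_zero mult_left_mono order_trans)
    then show ?thesis by simp
  qed
  define D where "D = 8 * ln 2 * (sqrt 2 - 1)"
  have D1: "D \<le> 8 * (25/36) * 0.41422" unfolding D_def using s l by (intro mult_mono) auto
  have D2: "8 * (2/3) * 0.41421 \<le> D" unfolding D_def using s l by (intro mult_mono) auto
  have c: "c_const = 15 * exp x / D" by (simp add: c_const_def D_def x_def)
  have "43 * D \<le> 15 * exp x" using D1 e1 by simp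
  then show "43 \<le> c_const" unfolding c using D2 by (simp add: pos_le_divide_eq)
  have "15 * exp x \<le> 47 * D" using D2 e2 by simp
  then show "c_const \<le> 47" unfolding c using D2 by (simp add: pos_divide_le_eq)
qed

lemma exp_quarter_le: "exp (1/4 :: real) \<le> 1.285"
proof (rule ccontr)
  assume "\<not> ?thesis"
  then have "1.285 ^ 4 < exp (1/4 :: real) ^ 4" by (intro power_strict_mono) auto
  also have "exp (1/4::real) ^ 4 = exp 1" by (simp flip: exp_of_nat_mult)
  finally show False using e_less_272 by (simp add: eval_nat_numeral)
qed

text \<open>
  The function \<open>l \<mapsto> l a / 2 + G / l\<close> has minimum \<open>sqrt (2 a G)\<close>, attained at \<open>l\<^sup>2 = 2 G / a\<close>.
  Tuning \<open>l\<close> to a value \<open>G'\<close> that is wrong by a factor of at most \<open>X\<close> replaces the \<open>2\<close> by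
  \<open>1 + (X + 1 / X) / 2\<close>.
\<close>

lemma two_term_sum_le:
  fixes l a G G' X C :: real
  assumes a: "0 < a" and G: "0 < G" "0 < G'" and l: "0 < l" "l\<^sup>2 = 2 * G' / a"
    and X: "0 < X" "G \<le> X * G'" "G' \<le> X * G" and C: "1 + (X + 1 / X) / 2 \<le> C"
  shows "l * a / 2 + G / l \<le> sqrt (C * a * G)"
proof (rule real_le_rsqrt)
  have "0 \<le> (X * G - G') * (X * G' - G)" using X by simp
  also have "\<dots> = X * ((X + 1 / X) * (G * G') - G\<^sup>2 - G'\<^sup>2)"
    using X by (simp add: power2_eq_square field_simps)
  finally have "G\<^sup>2 + G'\<^sup>2 \<le> (X + 1 / X) * (G * G')"
    using X by (simp add: zero_le_mult_iff)
  then have ratio: "G' + G\<^sup>2 / G' \<le> (X + 1 / X) * G"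
    using G by (simp add: power2_eq_square field_simps)
  have "(l * a / 2 + G / l)\<^sup>2 = l\<^sup>2 * a\<^sup>2 / 4 + a * G + G\<^sup>2 / l\<^sup>2"
    using l(1) by (simp add: power2_eq_square field_simps)
  also have "\<dots> = a * (G + (G' + G\<^sup>2 / G') / 2)"
    unfolding l(2) using a G by (simp add: power2_eq_square field_simps)
  also have "\<dots> \<le> a * (G + ((X + 1 / X) * G) / 2)"
    using a ratio by (intro mult_left_mono add_left_mono divide_right_mono) auto
  also have "\<dots> = (1 + (X + 1 / X) / 2) * (a * G)" by (simp add: algebra_simps)
  also have "\<dots> \<le> C * (a * G)" using C a G by (intro mult_right_mono) auto
  finally show "(l * a / 2 + G / l)\<^sup>2 \<le> C * a * G" by (simp add: mult.assoc)
qed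

text \<open>
  The number \<open>2 ln (s / t)\<close> lies between \<open>0\<close> and \<open>K - 1\<close>; the nearest integer is the index of the
  grid point.
\<close>

lemma exists_grid_point:
  fixes s t b :: real and K :: int
  assumes s: "0 < t" "t \<le> s" and b: "0 < b" "s * b \<le> n * t" and K: "K = 1 + \<lceil>2 * ln (n / b)\<rceil>"
  shows "\<exists>k < nat K. exp (- (1/4)) * t \<le> s * exp (- real k / 2) \<and> s * exp (- real k / 2) \<le> exp (1/4) * t"
proof -
  define x where "x = 2 * ln (s / t)"
  have x0: "0 \<le> x" using s by (simp add: x_def)
  have "s / t \<le> n / b" using s b by (simp add: field_simps)
  then have "ln (s / t) \<le> ln (n / b)" using s by (intro ln_mono) auto
  then have "x \<le> 2 * ln (n / b)" by (simp add: x_def)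
  also have "\<dots> \<le> of_int (K - 1)" using le_of_int_ceiling[of "2 * ln (n / b)"] by (simp add: K)
  finally have xK: "x \<le> of_int (K - 1)" .
  define k where "k = nat \<lfloor>x + 1/2\<rfloor>"
  have k: "real k = of_int \<lfloor>x + 1/2\<rfloor>" using x0 by (simp add: k_def)
  have k1: "real k \<le> x + 1/2" "x - 1/2 \<le> real k" unfolding k by linarith+
  have "\<lfloor>x + 1/2\<rfloor> \<le> K - 1" unfolding floor_le_iff using xK by simp
  then have "k < nat K" using x0 unfolding k_def by linarith
  moreover have st: "s = t * exp (x / 2)" using s by (simp add: x_def)
  moreover have "s * exp (- real k / 2) = exp (x / 2 - real k / 2) * t"
    unfolding st by (simp flip: exp_add)
  moreover have "exp (- (1/4)) \<le> exp (x / 2 - real k / 2)" "exp (x / 2 - real k / 2) \<le> exp (1/4)"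
    using k1 by auto
  ultimately show ?thesis using s by (intro exI[of _ k]) (auto intro!: mult_right_mono)
qed

text \<open>
  The value of \<open>lambda_star\<close> at \<open>t\<close>, as a function of \<open>s = E (\<parallel>X\<parallel>\<^sup>4)\<^bsup>1/2\<^esup>\<close> and of \<open>L = ln (K / \<epsilon>)\<close>. The
  same formula is evaluated at the grid points.
\<close>

definition lam_level :: "real \<Rightarrow> real \<Rightarrow> real \<Rightarrow> real \<Rightarrow> real \<Rightarrow> real" where
  "lam_level \<kappa> s n L t = sqrt (2 / (n * (\<kappa> - 1)) *
     ((2 + 3 * c_const) * s / (4 * (2 + c_const) * sqrt \<kappa> * t) + L))"

text \<open>
  The variance of each coordinate of the perturbation. It balances the perturbation error against the
  Kullback divergence at \<open>exp (1/4) t\<close> rather than at \<open>t\<close>: with this shift a grid point within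
  a factor \<open>exp (1/4)\<close> of the true value never makes the variance too large, so that the term
  quadratic in the variance needs no correction.
\<close>

definition pert_var :: "real \<Rightarrow> real \<Rightarrow> real \<Rightarrow> real \<Rightarrow> real" where
  "pert_var \<kappa> s n t = 1 / sqrt (90 * sqrt \<kappa> * s * n * (exp (1/4) * t))"

text \<open>
  The error splits into two sums of the form treated by \<open>two_term_sum_le\<close>. In the first one, the level
  is tuned to a grid point with mismatch \<open>exp (1/4) \<le> 1.285\<close>, which gives the factor \<open>2.032\<close>. In
  the second one, the perturbation has mismatch at most \<open>exp (1/2) \<le> 1.7\<close>, and
  \<open>2.15 * 45 \<le> 98.5\<close>. The condition on \<open>6 + 1 / (\<kappa> - 1)\<close> keeps the level \<open>l\<close> bounded.
\<close>

lemma parameter_bounds: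
  fixes \<kappa> s Tr n t tk L :: real
  assumes \<kappa>: "1 < \<kappa>" and s: "0 < s" "s \<le> sqrt \<kappa> * Tr" and n: "0 < n" and t: "0 < t" and L: "0 < L"
    and grid: "exp (- (1/4)) * t \<le> tk" "tk \<le> exp (1/4) * t"
    and D_def: "D = (sqrt (2.032 * (\<kappa> - 1) * (0.73 * Tr / t + L)) + sqrt (98.5 * \<kappa> * Tr / t)) / sqrt n"
    and cond: "(6 + inverse (\<kappa> - 1)) * D \<le> 1"
    and l_def: "l = lam_level \<kappa> s n L tk" and w_def: "w = pert_var \<kappa> s n tk"
  shows "0 < w" "0 < l" "0 \<le> D" "6 * D < 1" "l \<le> 1.14 * (1 - 6 * D)" "l * (\<kappa> - 1) / 2 \<le> 0.57 * D"
    "l\<^sup>2 \<le> exp (1/4) * (lam_level \<kappa> s n L t)\<^sup>2"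
    "l * (\<kappa> - 1) / 2 + 45 * w * (sqrt \<kappa> * s) + (1 / (2 * w * n)) / t
      + (65.5 * (w * s)\<^sup>2 + L / n) / l \<le> D"
proof -
  define a where "a = \<kappa> - 1"
  have a: "0 < a" using \<kappa> by (simp add: a_def)
  define q where "q = sqrt \<kappa>"
  have q: "1 < q" "q * q = \<kappa>" unfolding q_def using \<kappa> by simp_all
  define e :: real where "e = exp (1/4)"
  have e: "1 \<le> e" "e \<le> 1.285" "exp (- (1/4)) = 1 / e"
    unfolding e_def using exp_quarter_le by (simp_all add: exp_minus inverse_eq_divide)
  have tk: "t \<le> e * tk" "tk \<le> e * t" "0 < tk"
  proof -
    show "t \<le> e * tk" using grid(1) e by (simp add: field_simps)
    show "tk \<le> e * t" using grid(2) by (simp add: e_def)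
    have "0 < 1 / e * t" using e t by simp
    then show "0 < tk" using grid(1) unfolding e(3) by linarith
  qed
  define C where "C = (2 + 3 * c_const) / (4 * (2 + c_const))"
  have C: "131/180 \<le> C" "C \<le> 0.73" "0 < C"
    using c_const_bounds by (auto simp: C_def field_simps)
  define L1 where "L1 = (\<lambda>t. C * s / (q * t) + L)"
  have lam: "lam_level \<kappa> s n L t = sqrt (2 * (L1 t / n) / a)" for t
    by (simp add: lam_level_def L1_def C_def q_def a_def field_simps)
  have L1_pos: "0 < L1 t" if "0 < t" for t
    using that C s q L by (auto simp: L1_def intro!: add_nonneg_pos)
  have L1_mono: "L1 x \<le> e * L1 y" if xy: "0 < x" "0 < y" "y \<le> e * x" for x y
  proof -
    have "C * s / (q * x) \<le> e * (C * s / (q * y))"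
    proof -
      have "1 / x \<le> e / y" using xy by (simp add: field_simps)
      then have "(C * s / q) * (1 / x) \<le> (C * s / q) * (e / y)" using C s q by (intro mult_left_mono) auto
      then show ?thesis by (simp add: mult.commute)
    qed
    moreover have "1 * L \<le> e * L" using e L by (intro mult_right_mono) auto
    ultimately show ?thesis by (simp add: L1_def distrib_left)
  qed
  have Lk: "L1 tk \<le> e * L1 t" "L1 t \<le> e * L1 tk"
    using L1_mono[OF tk(3) t tk(1)] L1_mono[OF t tk(3,2)] by auto
  define Lz where "Lz = 0.73 * Tr / t + L"
  have "0 < q * Tr" using s by (simp add: q_def)
  then have Tr: "0 < Tr" using q by (simp add: zero_less_mult_iff)
  have L1z: "L1 t \<le> Lz"
  proof -
    have "C * s \<le> 0.73 * (q * Tr)" using C s q by (intro mult_mono) (auto simp: q_def)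
    then have "C * s / (q * t) \<le> 0.73 * (q * Tr) / (q * t)" using q t by (intro divide_right_mono) auto
    then show ?thesis using q by (simp add: L1_def Lz_def)
  qed
  define D1 where "D1 = sqrt (2.032 * a * (Lz / n))"
  define D2 where "D2 = sqrt (98.5 * (1 / (n * t)) * (\<kappa> * Tr))"
  have Lz: "0 < Lz" using L1z L1_pos[OF t] by linarith
  have D: "D = D1 + D2"
    unfolding D_def D1_def D2_def add_divide_distrib a_def[symmetric] Lz_def[symmetric] real_sqrt_divide[symmetric]
    by (simp add: mult.commute mult.left_commute)
  have D12: "0 \<le> D1" "0 < D2" using a Lz n t Tr \<kappa> by (auto simp: D1_def D2_def)
  show D0: "0 \<le> D" using D D12 by simp
  have inv: "0 < inverse (\<kappa> - 1)" using \<kappa> by simp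
  have Dpos: "0 < D" using D D12 by simp
  have "0 < inverse (\<kappa> - 1) * D" using inv Dpos by simp
  then show "6 * D < 1" using cond by (simp add: distrib_right)
  have l_sq: "l\<^sup>2 = 2 * (L1 tk / n) / a"
    using L1_pos[OF tk(3)] n a by (simp add: l_def lam)
  show l0: "0 < l" using L1_pos[OF tk(3)] n a by (simp add: l_def lam)
  show "l\<^sup>2 \<le> exp (1/4) * (lam_level \<kappa> s n L t)\<^sup>2"
  proof -
    have "2 * (L1 tk / n) / a \<le> 2 * ((e * L1 t) / n) / a"
      using Lk n a by (intro divide_right_mono mult_left_mono) auto
    then show ?thesis unfolding l_sq lam using L1_pos[OF t] n a by (simp add: e_def mult.left_commute)
  qed
  have laD1: "l * a \<le> 1.14 * D1"
  proof (rule power2_le_imp_le)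
    have "(l * a)\<^sup>2 = 2 * a * (L1 tk / n)" 
      unfolding power_mult_distrib l_sq using a by (simp add: power2_eq_square)
    also have "\<dots> \<le> 2 * a * ((1.285 * Lz) / n)"
    proof -
      have "e * L1 t \<le> 1.285 * Lz" using e L1z L1_pos[OF t] by (intro mult_mono) auto
      then have "L1 tk \<le> 1.285 * Lz" using Lk by linarith
      then show ?thesis using a n by (intro mult_left_mono divide_right_mono) auto
    qed
    also have "\<dots> = 2.57 * (a * (Lz / n))" by simp
    also have "\<dots> \<le> 2.64 * (a * (Lz / n))" using a Lz n by (intro mult_right_mono) auto
    also have "\<dots> \<le> (1.14 * D1)\<^sup>2"
      using a Lz n by (simp add: D1_def power_mult_distrib power2_eq_square field_simps)
    finally show "(l * a)\<^sup>2 \<le> (1.14 * D1)\<^sup>2" .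
  qed (use D12 in simp)
  then have laD: "l * a \<le> 1.14 * D" using D D12 by simp
  then show "l * (\<kappa> - 1) / 2 \<le> 0.57 * D" unfolding a_def[symmetric] by linarith
  show "l \<le> 1.14 * (1 - 6 * D)"
  proof -
    have "l \<le> 1.14 * (D / a)" using laD a by (simp add: field_simps)
    also have "\<dots> \<le> 1.14 * (1 - 6 * D)"
    proof (rule mult_left_mono)
      have "(6 + 1 / a) * D \<le> 1" using cond by (simp add: a_def inverse_eq_divide)
      then show "D / a \<le> 1 - 6 * D" by (simp add: distrib_right)
    qed simp
    finally show ?thesis .
  qed
  define g where "g = 45 * (q * s)"
  have g: "0 < g" using q s by (simp add: g_def)
  define b where "b = sqrt (90 * q * s * n * (e * tk))"
  have b: "0 < b" "b\<^sup>2 = 90 * q * s * n * (e * tk)" using q s n e tk by (auto simp: b_def)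
  have w: "w = 1 / b" by (simp add: w_def pert_var_def b_def q_def e_def)
  show "0 < w" using b by (simp add: w)
  have part1: "l * a / 2 + (L1 t / n) / l \<le> D1"
  proof -
    have "l * a / 2 + (L1 t / n) / l \<le> sqrt (2.032 * a * (L1 t / n))"
    proof (rule two_term_sum_le[where X = "1.285", OF a _ _ l0 l_sq])
      have "e * L1 tk \<le> 1.285 * L1 tk" "e * L1 t \<le> 1.285 * L1 t"
        using e L1_pos[OF t] L1_pos[OF tk(3)] by (intro mult_right_mono; simp)+
      then have "L1 t \<le> 1.285 * L1 tk" "L1 tk \<le> 1.285 * L1 t" using Lk by auto
      then show "L1 t / n \<le> 1.285 * (L1 tk / n)" "L1 tk / n \<le> 1.285 * (L1 t / n)"
        using n by (auto simp: field_simps)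
    qed (use L1_pos[OF t] L1_pos[OF tk(3)] n in auto)
    also have "\<dots> \<le> D1" unfolding D1_def using a n L1z by (intro real_sqrt_le_mono mult_left_mono divide_right_mono) auto
    finally show ?thesis .
  qed
  have part2: "g / b + b / (2 * n) / t \<le> D2"
  proof -
    have "b * (1 / (n * t)) / 2 + g / b \<le> sqrt (2.15 * (1 / (n * t)) * g)"
    proof (rule two_term_sum_le[where X = "1.7" and G' = "g * (e * tk) / t", OF _ g _ b(1)])
      show "b\<^sup>2 = 2 * (g * (e * tk) / t) / (1 / (n * t))" unfolding b(2) using n t by (simp add: g_def)
      have "g * (e * tk) / t \<le> g * (1.7 * t) / t"
      proof -
        have "e * tk \<le> e * (e * t)" using tk e by (intro mult_left_mono) auto
        also have "\<dots> \<le> 1.285 * (1.285 * t)" using e t by (intro mult_mono) auto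
        also have "\<dots> \<le> 1.7 * t" using t by simp
        finally show ?thesis using g t by (intro divide_right_mono mult_left_mono) auto
      qed
      then show "g * (e * tk) / t \<le> 1.7 * g" using t by simp
      have "g * t / t \<le> g * (e * tk) / t" using g t tk by (intro divide_right_mono mult_left_mono) auto
      then have "g \<le> g * (e * tk) / t" using t by simp
      moreover have "0 < g * (e * tk) / t" using g e tk t by simp
      ultimately show "g \<le> 1.7 * (g * (e * tk) / t)" by simp
      show "0 < g * (e * tk) / t" using g e tk t by simp
    qed (use n t in auto)
    also have "\<dots> \<le> D2"
    proof -
      have "q * s \<le> q * (q * Tr)" using s q by (intro mult_left_mono) (auto simp: q_def)
      then have "q * s \<le> \<kappa> * Tr" using q by (simp flip: mult.assoc)
      moreover have "0 \<le> \<kappa> * Tr" using Tr \<kappa> by simp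
      ultimately have "2.15 * g \<le> 98.5 * (\<kappa> * Tr)" unfolding g_def by simp
      then have "(1 / (n * t)) * (2.15 * g) \<le> (1 / (n * t)) * (98.5 * (\<kappa> * Tr))"
        using n t by (intro mult_left_mono) auto
      then show ?thesis unfolding D2_def by (intro real_sqrt_le_mono) (simp add: mult_ac)
    qed
    finally show ?thesis by (simp add: mult_ac add.commute)
  qed
  have E2: "65.5 * (w * s)\<^sup>2 + L / n \<le> L1 t / n"
  proof -
    have "65.5 * (w * s)\<^sup>2 = 65.5 * s\<^sup>2 / b\<^sup>2" by (simp add: w power_mult_distrib power_divide)
    also have "\<dots> = (131/180) * s / (q * n * (e * tk))" unfolding b(2) using s q n by (simp add: power2_eq_square)
    also have "\<dots> \<le> C * s / (q * n * t)"
      using C s q n t tk by (intro frac_le mult_right_mono mult_left_mono mult_pos_pos mult_nonneg_nonneg) auto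
    finally show ?thesis using n by (simp add: L1_def add_divide_distrib mult.commute mult.left_commute)
  qed
  have "(65.5 * (w * s)\<^sup>2 + L / n) / l \<le> (L1 t / n) / l" using E2 l0 by (intro divide_right_mono) auto
  moreover have "45 * w * (sqrt \<kappa> * s) = g / b" by (simp add: w g_def q_def)
  moreover have "(1 / (2 * w * n)) / t = b / (2 * n) / t" using b by (simp add: w)
  ultimately show "l * (\<kappa> - 1) / 2 + 45 * w * (sqrt \<kappa> * s) + (1 / (2 * w * n)) / t
      + (65.5 * (w * s)\<^sup>2 + L / n) / l \<le> D"
    using part1 part2 unfolding D a_def[symmetric] by linarith
qed

section \<open>The uniform bound for the empirical estimator\<close>

text \<open>
  The union bound for the complements.
\<close>

lemma (in prob_space) measure_finite_Inter_ge:
  assumes J: "finite J" and A: "\<And>j. j \<in> J \<Longrightarrow> A j \<in> events \<and> 1 - e \<le> prob (A j)"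
  shows "\<exists>B \<in> events. 1 - real (card J) * e \<le> prob B \<and> (\<forall>j \<in> J. B \<subseteq> A j)"
proof -
  define U where "U = (\<Union>j\<in>J. space M - A j)"
  have U: "U \<in> events" unfolding U_def using J A by (intro sets.finite_UN) auto
  have "prob U \<le> (\<Sum>j\<in>J. prob (space M - A j))"
    unfolding U_def using J A by (intro finite_measure_subadditive_finite) auto
  also have "\<dots> \<le> (\<Sum>j\<in>J. e)" 
  proof (rule sum_mono)
    fix j assume "j \<in> J"
    then show "prob (space M - A j) \<le> e" using A[of j] by (simp add: prob_compl)
  qed
  finally have "prob U \<le> real (card J) * e" by simp
  then have "1 - real (card J) * e \<le> prob (space M - U)" using U by (simp add: prob_compl)
  moreover have "space M - U \<subseteq> A j" if "j \<in> J" for j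
    using that A sets.sets_into_space by (auto simp: U_def)
  ultimately show ?thesis using U by (intro bexI[of _ "space M - U"]) auto
qed

lemma (in fourth_moment) kurtosis_sup_imp_le:
  assumes "kurtosis_sup P = ereal \<kappa>"
  shows "(\<integral>x. (\<theta> \<bullet> x) ^ 4 \<partial>P) \<le> \<kappa> * (quad_form P \<theta>)\<^sup>2"
proof (cases "quad_form P \<theta> > 0")
  case True
  then have "ereal ((\<integral>x. (\<theta> \<bullet> x) ^ 4 \<partial>P) / (quad_form P \<theta>)\<^sup>2) \<le> kurtosis_sup P"
    unfolding kurtosis_sup_def by (intro SUP_upper) auto
  then show ?thesis using True assms by (simp add: pos_divide_le_eq)
next
  case False
  then have "quad_form P \<theta> = 0" using quad_form_nonneg[of \<theta>] by simp
  then have "AE x in P. (\<theta> \<bullet> x)\<^sup>2 = 0"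
    using integral_nonneg_eq_0_iff_AE[OF moment_inner2[of \<theta>]] by (simp add: quad_form_def)
  then have "AE x in P. (\<theta> \<bullet> x) ^ 4 = 0" by eventually_elim simp
  then have "(\<integral>x. (\<theta> \<bullet> x) ^ 4 \<partial>P) = 0" by (rule integral_eq_zero_AE)
  then show ?thesis by (simp add: \<open>quad_form P \<theta> = 0\<close>)
qed

text \<open>
  A finite supremum is not taken over the empty set, so some direction has positive second moment.
\<close>

lemma (in fourth_moment) s4_pos:
  assumes "kurtosis_sup P = ereal \<kappa>"
  shows "0 < s4"
proof -
  have "{\<theta>. quad_form P \<theta> > 0} \<noteq> {}"
  proof
    assume "{\<theta>. quad_form P \<theta> > 0} = {}"
    then have "kurtosis_sup P = - \<infinity>" unfolding kurtosis_sup_def by (simp add: bot_ereal_def)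
    then show False using assms by simp
  qed
  then obtain \<theta> where \<theta>: "0 < quad_form P \<theta>" by auto
  have "quad_form P \<theta> \<le> (norm \<theta>)\<^sup>2 * trace (gram P)"
    by (rule quad_form_le_trace)
  then have "0 < (norm \<theta>)\<^sup>2 * trace (gram P)" using \<theta> by linarith
  then have "0 < trace (gram P)" using trace_nonneg by (simp add: zero_less_mult_iff)
  then show ?thesis using trace_le_s4 by linarith
qed

lemma deviation_bound_ereal:
  "deviation_bound (ereal B) \<tau> = (if \<tau> < 1 \<and> B < 1 then ereal (B + \<tau> / ((1 - \<tau>) * (1 - B))) else \<infinity>)"
proof -
  have pos_part: "max (1 - ereal x) 0 = ereal (max (1 - x) 0)" for x
    by (simp add: max_def zero_ereal_def one_ereal_def)
  show ?thesis
    unfolding deviation_bound_def pos_part by (auto simp: max_def zero_ereal_def)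
qed

text \<open>
  In the upper direction, \<open>(1 + D) / (1 - \<tau>) - 1 = D + (1 + D) \<tau> / (1 - \<tau>)\<close>, and
  \<open>D \<le> B\<close> together with \<open>1 + D \<le> 1 / (1 - B)\<close> turns this into the claimed bound. The threshold
  \<open>\<sigma>\<close> can only bring the ratio closer to \<open>1\<close>; in particular the lower direction is trivial
  unless \<open>\<sigma> < N\<close>.
\<close>

lemma two_sided_deviation:
  fixes m N \<sigma> t \<tau> \<tau>' D B :: real
  assumes t: "0 < t" "t = max N \<sigma>" and D: "0 \<le> D" "6 * D < 1" and B: "B = D / (1 - 4 * D)"
    and \<tau>: "0 \<le> \<tau>'" "\<tau>' \<le> \<tau>" "\<tau> < 1" and m: "0 \<le> m"
    and upper: "(1 - \<tau>') * (m / t) \<le> 1 + D"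
    and lower: "\<sigma> < N \<Longrightarrow> (1 - B) - \<tau>' / (1 - B) \<le> m / t"
  shows "\<bar>max m \<sigma> / t - 1\<bar> \<le> B + \<tau> / ((1 - \<tau>) * (1 - B))"
proof -
  have B1: "D \<le> B" "B < 1" "0 \<le> B"
  proof -
    have "D * (1 - 4 * D) \<le> D * 1" using D by (intro mult_left_mono) auto
    then show "D \<le> B" using D by (simp add: B pos_le_divide_eq)
    show "B < 1" "0 \<le> B" using D by (auto simp: B)
  qed
  have "(1 + D) * (1 - B) \<le> (1 + B) * (1 - B)" using B1 by (intro mult_right_mono) auto
  also have "\<dots> \<le> 1" by (simp add: algebra_simps)
  finally have inv: "1 + D \<le> 1 / (1 - B)" using B1 by (simp add: pos_le_divide_eq)
  have nonneg: "0 \<le> B + \<tau> / ((1 - \<tau>) * (1 - B))" using B1 \<tau> by simp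
  have up: "m / t - 1 \<le> B + \<tau> / ((1 - \<tau>) * (1 - B))"
  proof -
    have "(1 - \<tau>) * (m / t) \<le> (1 - \<tau>') * (m / t)" using \<tau> m t by (intro mult_right_mono) auto
    then have "m / t \<le> (1 + D) / (1 - \<tau>)" using upper \<tau> by (simp add: pos_le_divide_eq mult.commute)
    also have "\<dots> = 1 + D + \<tau> / (1 - \<tau>) * (1 + D)" using \<tau> by (simp add: field_simps)
    also have "\<dots> \<le> 1 + B + \<tau> / (1 - \<tau>) * (1 / (1 - B))"
      using B1 \<tau> inv by (intro add_mono mult_left_mono) auto
    finally show ?thesis by simp
  qed
  have 1: "max m \<sigma> / t - 1 \<le> B + \<tau> / ((1 - \<tau>) * (1 - B))"
  proof (cases "\<sigma> \<le> m")
    case False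
    then have "max m \<sigma> / t \<le> 1" using t by simp
    then show ?thesis using nonneg by linarith
  qed (use up in \<open>simp add: max_def\<close>)
  have 2: "1 - max m \<sigma> / t \<le> B + \<tau> / ((1 - \<tau>) * (1 - B))"
  proof (cases "\<sigma> < N")
    case True
    have "\<tau>' / (1 - B) \<le> \<tau> / ((1 - \<tau>) * (1 - B))"
    proof (rule frac_le)
      show "(1 - \<tau>) * (1 - B) \<le> 1 - B" using B1 \<tau> by (simp add: mult_left_le_one_le)
    qed (use B1 \<tau> in auto)
    moreover have "m / t \<le> max m \<sigma> / t" using t by (intro divide_right_mono) auto
    ultimately show ?thesis using lower[OF True] by linarith
  next
    case False
    then have "1 \<le> max m \<sigma> / t" using t by (simp add: pos_le_divide_eq)
    then show ?thesis using nonneg by linarith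
  qed
  show ?thesis using 1 2 by linarith
qed

theorem proposition5p1:
  fixes P :: "(real ^ 'd) measure"
    and M :: "'w measure"
    and X :: "nat \<Rightarrow> 'w \<Rightarrow> real ^ 'd"
    and n :: nat
    and \<kappa> \<epsilon> \<sigma> :: real
  assumes P: "prob_space P" "sets P = sets borel"
    and moment: "integrable P (\<lambda>x. norm x ^ 4)"
    and kappa: "kurtosis_sup P = ereal \<kappa>" "\<kappa> > 1"
    and M: "prob_space M"
    and n: "n \<ge> 1"
    and indep: "prob_space.indep_vars M (\<lambda>_. borel) X {1..n}"
    and law: "\<And>i. i \<in> {1..n} \<Longrightarrow> distr M borel (X i) = P"
    and K: "K_const \<kappa> n \<ge> 1"
    and eps: "0 < \<epsilon>" "\<epsilon> < 1"
    and sigma: "0 \<le> \<sigma>" "\<sigma> \<le> sqrt (\<integral>x. norm x ^ 4 \<partial>P)"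
  shows "\<exists>A \<in> sets M. measure M A \<ge> 1 - 2 * \<epsilon> \<and>
    (\<forall>\<omega> \<in> A. \<forall>\<theta>. norm \<theta> = 1 \<longrightarrow>
      ereal \<bar>max (emp_quad_form n (\<lambda>i. X i \<omega>) \<theta>) \<sigma> / max (quad_form P \<theta>) \<sigma> - 1\<bar>
      \<le> deviation_bound (B_star P \<kappa> n \<epsilon> \<sigma> (quad_form P \<theta>))
          (tau_star P \<kappa> n \<epsilon> \<sigma> (sample_radius n (\<lambda>i. X i \<omega>)) (quad_form P \<theta>)))"
proof -
  interpret fourth_moment P by (rule fourth_moment.intro[OF P moment])
  interpret kurtosis_bound P \<kappa>
  proof (rule kurtosis_bound.intro[OF fourth_moment_axioms kurtosis_bound_axioms.intro])
    show "0 \<le> \<kappa>" using kappa by simp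
    show "(\<integral>x. (\<theta> \<bullet> x) ^ 4 \<partial>P) \<le> \<kappa> * (quad_form P \<theta>)\<^sup>2" for \<theta>
      by (rule kurtosis_sup_imp_le[OF kappa(1)])
  qed
  interpret M: prob_space M by fact
  have s4: "0 < s4" by (rule s4_pos[OF kappa(1)])
  define k where "k = real_of_int (K_const \<kappa> n)"
  define L where "L = ln (k / \<epsilon>)"
  have k: "1 \<le> k" "real (nat (K_const \<kappa> n)) = k" using K by (auto simp: k_def)
  have L: "0 < L" "L = ln k + ln (inverse \<epsilon>)" "ln (1 / (\<epsilon> / k)) = L"
    using k eps by (auto simp: L_def ln_div ln_inverse)
  define tg where "tg = (\<lambda>j::nat. s4 * exp (- real j / 2))"
  define l where "l = (\<lambda>j. lam_level \<kappa> s4 n L (tg j))"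
  define w where "w = (\<lambda>j. pert_var \<kappa> s4 n (tg j))"
  have w: "0 < w j" for j using s4 n kappa by (simp add: w_def tg_def pert_var_def)
  define J where "J = {..<nat (K_const \<kappa> n)} \<times> {1, -1 :: real}"
  define good where "good = (\<lambda>(j, \<delta>) \<omega>. \<forall>\<theta>.
    (\<Sum>i\<in>{1..n}. soft_clip (\<delta> * ((\<theta> \<bullet> X i \<omega>)\<^sup>2 - l j)))
      \<le> real n * (\<delta> * (quad_form P \<theta> - l j)
          + (\<kappa> * (quad_form P \<theta>)\<^sup>2 - 2 * l j * quad_form P \<theta> + (l j)\<^sup>2) / 2
          + 45 * w j * (sqrt \<kappa> * quad_form P \<theta> * s4) + 65.5 * (w j * s4)\<^sup>2)
        + (norm \<theta>)\<^sup>2 / (2 * w j) + L)"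
  have "\<exists>A. A \<in> sets M \<and> 1 - \<epsilon> / k \<le> measure M A \<and> (\<forall>\<omega>\<in>A. good p \<omega>)" if p: "p \<in> J" for p
  proof -
    obtain j \<delta> where jd: "p = (j, \<delta>)" "\<delta>\<^sup>2 = 1" using p by (auto simp: J_def)
    show ?thesis
      using uniform_soft_clip_bound[OF M _ indep law _ _ jd(2), of "sqrt (w j)" "\<epsilon> / k" "l j"] w[of j] eps k
      unfolding jd(1) good_def case_prod_conv L(3) by auto
  qed
  then obtain A where A: "\<And>p. p \<in> J \<Longrightarrow> A p \<in> sets M \<and> 1 - \<epsilon> / k \<le> measure M (A p)"
    and A_good: "\<And>p \<omega>. p \<in> J \<Longrightarrow> \<omega> \<in> A p \<Longrightarrow> good p \<omega>"
    by metis
  have J: "finite J" "real (card J) = 2 * k"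
    using k by (auto simp: J_def card_cartesian_product)
  obtain S where S: "S \<in> sets M" "1 - real (card J) * (\<epsilon> / k) \<le> measure M S" "\<And>p. p \<in> J \<Longrightarrow> S \<subseteq> A p"
    using M.measure_finite_Inter_ge[OF J(1), of A "\<epsilon> / k"] A by blast
  have meas: "1 - 2 * \<epsilon> \<le> measure M S" using S(2) k unfolding J(2) by simp
  have "ereal \<bar>max (emp_quad_form n (\<lambda>i. X i \<omega>) \<theta>) \<sigma> / max (quad_form P \<theta>) \<sigma> - 1\<bar>
      \<le> deviation_bound (B_star P \<kappa> n \<epsilon> \<sigma> (quad_form P \<theta>))
          (tau_star P \<kappa> n \<epsilon> \<sigma> (sample_radius n (\<lambda>i. X i \<omega>)) (quad_form P \<theta>))"
    if \<omega>: "\<omega> \<in> S" and \<theta>: "norm \<theta> = 1" for \<omega> \<theta>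
  proof (cases "B_star P \<kappa> n \<epsilon> \<sigma> (quad_form P \<theta>) = \<infinity>")
    case True
    then show ?thesis by (simp add: deviation_bound_def)
  next
    case False
    define N where "N = quad_form P \<theta>"
    define t where "t = max N \<sigma>"
    define Tr where "Tr = trace (gram P)"
    define D where "D = zeta_star P \<kappa> n \<epsilon> t / sqrt n"
    define B where "B = D / (1 - 4 * D)"
    define R where "R = sample_radius n (\<lambda>i. X i \<omega>)"
    define \<tau> where "\<tau> = tau_star P \<kappa> n \<epsilon> \<sigma> R N"
    define Y where "Y = (\<lambda>i. (\<theta> \<bullet> X i \<omega>)\<^sup>2)"
    have n0: "0 < real n" using n by simp
    have fin: "0 < t" "(6 + inverse (\<kappa> - 1)) * zeta_star P \<kappa> n \<epsilon> t \<le> sqrt n"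
      and Beq: "B_star P \<kappa> n \<epsilon> \<sigma> N = ereal B"
      using False unfolding B_star_def Let_def N_def[symmetric] t_def[symmetric] D_def B_def
      by (auto split: if_splits)
    have cond: "(6 + inverse (\<kappa> - 1)) * D \<le> 1"
      using fin(2) n0 by (simp add: D_def field_simps)
    have D_eq: "D = (sqrt (2.032 * (\<kappa> - 1) * (0.73 * Tr / t + L)) + sqrt (98.5 * \<kappa> * Tr / t)) / sqrt n"
      unfolding D_def zeta_star_def L(2) Tr_def k_def by (simp add: add.assoc)
    have s4_Tr: "s4 \<le> sqrt \<kappa> * Tr" unfolding Tr_def by (rule s4_le_trace)
    have Tr0: "0 \<le> Tr" unfolding Tr_def by (rule trace_nonneg)
    have N0: "0 \<le> N" unfolding N_def by (rule quad_form_nonneg)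
    have t_le: "t \<le> s4"
      using quad_form_le_trace[of \<theta>] trace_le_s4 sigma(2) \<theta> by (simp add: t_def N_def s4_def)
    \<comment> \<open>Finiteness of the bound forces 6 D \<le> 1; the second summand of D then makes n so large that
      t lies in the range covered by the grid, because 72 (2 + c) \<le> 36 * 98.5.\<close>
    have large_n: "s4 * (72 * (2 + c_const) * sqrt \<kappa>) \<le> real n * t"
    proof -
      have "0 \<le> sqrt (2.032 * (\<kappa> - 1) * (0.73 * Tr / t + L)) / sqrt n"
        using kappa Tr0 fin L n0 by simp
      then have D2: "sqrt (98.5 * \<kappa> * Tr / t) / sqrt n \<le> D" unfolding D_eq add_divide_distrib by linarith
      have "0 \<le> sqrt (98.5 * \<kappa> * Tr / t) / sqrt n" using kappa Tr0 fin n0 by simp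
      then have "0 \<le> inverse (\<kappa> - 1) * D" using D2 kappa by simp
      then have "6 * D \<le> 1" using cond by (simp add: distrib_right)
      then have "sqrt (98.5 * \<kappa> * Tr / t) / sqrt n \<le> 1/6" using D2 by linarith
      then have "sqrt (98.5 * \<kappa> * Tr / t) \<le> sqrt n * (1/6)"
        using n0 by (simp only: pos_divide_le_eq real_sqrt_gt_0_iff mult.commute)
      then have "98.5 * \<kappa> * Tr / t \<le> (sqrt n * (1/6))\<^sup>2" by (rule sqrt_le_D)
      also have "\<dots> = n / 36" by (simp add: power_mult_distrib power2_eq_square)
      finally have big: "3546 * (\<kappa> * Tr) \<le> n * t" using fin by (simp add: field_simps)
      have "s4 * (72 * (2 + c_const) * sqrt \<kappa>) \<le> (sqrt \<kappa> * Tr) * (3546 * sqrt \<kappa>)"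
        using s4_Tr c_const_bounds Tr0 kappa s4 by (intro mult_mono mult_right_mono) auto
      also have "\<dots> = 3546 * (\<kappa> * Tr)" using kappa by (simp add: mult_ac flip: real_sqrt_mult)
      finally show ?thesis using big by linarith
    qed
    obtain j where j: "j < nat (K_const \<kappa> n)" "exp (- (1/4)) * t \<le> tg j" "tg j \<le> exp (1/4) * t"
    proof -
      have "0 < 72 * (2 + c_const) * sqrt \<kappa>" using c_const_bounds kappa by simp
      from exists_grid_point[OF fin(1) t_le this large_n, of "K_const \<kappa> n"] that show ?thesis
        by (auto simp: K_const_def a_const_def tg_def)
    qed
    note par = parameter_bounds[OF kappa(2) s4 s4_Tr n0 fin(1) L(1) j(2,3) D_eq cond refl refl]
    define lj where "lj = l j"
    define wj where "wj = w j"
    have "0 < wj" "0 < lj" "0 \<le> D" "6 * D < 1" and lj: "lj \<le> 1.14 * (1 - 6 * D)"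
      "lj * (\<kappa> - 1) / 2 \<le> 0.57 * D" "lj\<^sup>2 \<le> exp (1/4) * (lam_level \<kappa> s4 n L t)\<^sup>2"
      and sum_le: "lj * (\<kappa> - 1) / 2 + 45 * wj * (sqrt \<kappa> * s4) + (1 / (2 * wj * n)) / t
      + (65.5 * (wj * s4)\<^sup>2 + L / n) / lj \<le> D"
      using par unfolding lj_def wj_def l_def w_def by blast+
    have Y: "0 \<le> Y i \<and> Y i \<le> R\<^sup>2" if i: "i \<in> {1..n}" for i
    proof -
      have "norm (X i \<omega>) \<le> R" unfolding R_def sample_radius_def using i by (intro Max_ge) auto
      then have "(norm (X i \<omega>))\<^sup>2 \<le> R\<^sup>2" by (intro power_mono) auto
      then show ?thesis using inner_power2_le[of \<theta> "X i \<omega>"] \<theta> by (simp add: Y_def)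
    qed
    have emp: "emp_quad_form n (\<lambda>i. X i \<omega>) \<theta> = (\<Sum>i\<in>{1..n}. Y i) / n"
      by (simp add: emp_quad_form_def Y_def)
    define E1 where "E1 = 45 * wj * (sqrt \<kappa> * s4)"
    define E2 where "E2 = 65.5 * (wj * s4)\<^sup>2 + L / n"
    define pen where "pen = 1 / (2 * wj * n)"
    have dev: "(\<Sum>i\<in>{1..n}. soft_clip (\<delta> * (s * Y i - lj))) \<le> real n *
        (\<delta> * (s * N - lj) + (\<kappa> * (s * N)\<^sup>2 - 2 * lj * (s * N) + lj\<^sup>2) / 2 + s * N * E1 + s * pen + E2)"
      if s: "0 \<le> s" and \<delta>: "\<delta> \<in> {1, -1}" for s \<delta>
    proof -
      \<comment> \<open>The direction of length sqrt s along \<theta> has quadratic form s N and divergence s / (2 w).\<close>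
      have p: "(j, \<delta>) \<in> J" using j \<delta> by (simp add: J_def)
      have g: "good (j, \<delta>) \<omega>" using A_good[OF p] S(3)[OF p] \<omega> by blast
      have 1: "((sqrt s *\<^sub>R \<theta>) \<bullet> X i \<omega>)\<^sup>2 = s * Y i" for i
        using s by (simp add: Y_def power_mult_distrib)
      have 2: "quad_form P (sqrt s *\<^sub>R \<theta>) = s * N"
        using s quad_form_scale[of "sqrt s" \<theta>] by (simp add: N_def)
      have 3: "(norm (sqrt s *\<^sub>R \<theta>))\<^sup>2 = s" using s \<theta> by simp
      have "(\<Sum>i\<in>{1..n}. soft_clip (\<delta> * (s * Y i - lj)))
        \<le> real n * (\<delta> * (s * N - lj) + (\<kappa> * (s * N)\<^sup>2 - 2 * lj * (s * N) + lj\<^sup>2) / 2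
          + 45 * wj * (sqrt \<kappa> * (s * N) * s4) + 65.5 * (wj * s4)\<^sup>2) + s / (2 * wj) + L"
        using g[unfolded good_def case_prod_conv, rule_format, of "sqrt s *\<^sub>R \<theta>"]
        unfolding 1 2 3 lj_def[symmetric] wj_def[symmetric] .
      also have "\<dots> = real n *
        (\<delta> * (s * N - lj) + (\<kappa> * (s * N)\<^sup>2 - 2 * lj * (s * N) + lj\<^sup>2) / 2 + s * N * E1 + s * pen + E2)"
      proof -
        have "real n * (s * pen) = s / (2 * wj)" "real n * (L / n) = L"
          using n0 by (simp_all add: pen_def)
        then show ?thesis by (simp add: E1_def E2_def distrib_left mult_ac)
      qed
      finally show ?thesis .
    qed
    define \<tau>' where "\<tau>' = (lj * R\<^sup>2 / t)\<^sup>2 / 3"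
    have "\<tau>' \<le> \<tau>"
    proof -
      have "lambda_star P \<kappa> n \<epsilon> \<sigma> N = lam_level \<kappa> s4 n L t"
        by (simp add: lambda_star_def lam_level_def s4_def L_def k_def t_def)
      then have "\<tau> = (exp (1/4) * (lam_level \<kappa> s4 n L t)\<^sup>2) * (R ^ 4 / (3 * t\<^sup>2))"
        by (simp add: \<tau>_def tau_star_def a_const_def t_def)
      moreover have "\<tau>' = lj\<^sup>2 * (R ^ 4 / (3 * t\<^sup>2))"
        by (simp add: \<tau>'_def power_mult_distrib power_divide flip: power_mult)
      ultimately show ?thesis using lj(3) mult_right_mono[of _ _ "R ^ 4 / (3 * t\<^sup>2)"] by simp
    qed
    have I: "finite {1..n}" "{1..n} \<noteq> {}" "card {1..n} = n" using n by auto
    have upper: "(1 - \<tau>') * (emp_quad_form n (\<lambda>i. X i \<omega>) \<theta> / t) \<le> 1 + D"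
      unfolding \<tau>'_def emp
    proof (rule relative_upper_deviation[OF I(1,2) Y, unfolded I(3)])
      show "0 \<le> N" "N \<le> t" "0 < t" "0 < lj" "0 \<le> \<kappa> - 1" by (use N0 fin kappa \<open>0 < lj\<close> in \<open>auto simp: t_def\<close>)
      show "lj \<le> 2" using lj(1) \<open>0 \<le> D\<close> by simp
      show "0 \<le> E1" using \<open>0 < wj\<close> s4 kappa by (simp add: E1_def)
      show "lj * (\<kappa> - 1) / 2 + E1 + pen / t + E2 / lj \<le> D"
        using sum_le by (simp add: E1_def E2_def pen_def)
      show "(\<Sum>i\<in>{1..n}. soft_clip (s * Y i - lj)) \<le> real n *
        ((s * N - lj) + ((1 + (\<kappa> - 1)) * (s * N)\<^sup>2 - 2 * lj * (s * N) + lj\<^sup>2) / 2 + s * N * E1 + s * pen + E2)"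
        if "0 \<le> s" for s
        using dev[OF that, of 1] by simp
    qed
    have lower: "(1 - B) - \<tau>' / (1 - B) \<le> emp_quad_form n (\<lambda>i. X i \<omega>) \<theta> / t" if "\<sigma> < N"
    proof -
      have tN: "t = N" using that by (simp add: t_def)
      show ?thesis unfolding \<tau>'_def emp
      proof (rule relative_lower_deviation[OF I(1,2) Y, unfolded I(3),
          where a = "\<kappa> - 1" and ?E1.0 = E1 and ?E2.0 = E2 and pen = pen and D = D])
        show "0 < t" "0 < lj" "0 \<le> \<kappa> - 1" "0 \<le> D" "6 * D < 1" "B = D / (1 - 4 * D)"
          by (use fin kappa \<open>0 < lj\<close> \<open>0 \<le> D\<close> \<open>6 * D < 1\<close> in \<open>auto simp: B_def\<close>)
        show "lj \<le> 1.14 * (1 - 6 * D)" "lj * (\<kappa> - 1) / 2 \<le> 0.57 * D" by fact+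
        show "0 \<le> E2" using L n0 by (simp add: E2_def)
        show "lj * (\<kappa> - 1) / 2 + E1 + pen / t + E2 / lj \<le> D"
          using sum_le by (simp add: E1_def E2_def pen_def)
        show "(\<Sum>i\<in>{1..n}. soft_clip (lj - s * Y i)) \<le> real n *
          ((lj - s * t) + ((1 + (\<kappa> - 1)) * (s * t)\<^sup>2 - 2 * lj * (s * t) + lj\<^sup>2) / 2 + s * t * E1 + s * pen + E2)"
          if "0 \<le> s" for s
          using dev[OF that, of "-1"] unfolding tN by simp
      qed
    qed
    have emp0: "0 \<le> emp_quad_form n (\<lambda>i. X i \<omega>) \<theta>"
      unfolding emp using Y by (intro divide_nonneg_nonneg sum_nonneg) auto
    have "0 \<le> \<tau>'" by (simp add: \<tau>'_def)
    have "ereal \<bar>max (emp_quad_form n (\<lambda>i. X i \<omega>) \<theta>) \<sigma> / t - 1\<bar> \<le> deviation_bound (ereal B) \<tau>"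
    proof (cases "\<tau> < 1")
      case True
      show ?thesis
        using two_sided_deviation[OF fin(1) t_def \<open>0 \<le> D\<close> \<open>6 * D < 1\<close> B_def \<open>0 \<le> \<tau>'\<close> \<open>\<tau>' \<le> \<tau>\<close> True emp0 upper lower]
        by (simp add: deviation_bound_ereal)
    qed (simp add: deviation_bound_ereal)
    then show ?thesis unfolding Beq[symmetric] t_def \<tau>_def R_def N_def .
  qed
  then show ?thesis using S(1) meas by blast
qed

end
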